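(* Let $\mathcal{G}_{6,5}$ be the real Lie algebra with basis $x_1,\dots,x_6$ and nonzero brackets $[x_1,x_2]=x_4$, $[x_1,x_4]=x_5$, $[x_2,x_3]=x_6$, $[x_2,x_4]=x_6$. For real $c,r,s$ with $cs\neq0$ put $$a=-\frac{r^2+1-src}{sc},\qquad b=-(r+c-sc),$$ $$J(c,r,s)=\mathrm{diag}\left(\begin{pmatrix} a & -(a^2+1) \\ 1 & -a \end{pmatrix},\begin{pmatrix} b & -\frac{b^2+1}{c} \\ c & -b \end{pmatrix},\begin{pmatrix} r & -\frac{r^2+1}{s} \\ s & -r \end{pmatrix}\right).$$ Then: (1) the set $\mathfrak{X}_{6,5}$ of all complex structures on $\mathcal{G}_{6,5}$ is a submanifold of dimension 10 of $\mathbb{R}^{36}$; (2) every complex structure on $\mathcal{G}_{6,5}$ is equivalent to some $J(c,r,s)$ with $cs\ne0$; (3) $J(c,r,s)$ and $J(c',r',s')$ (with $cs\neq0$, $c's'\neq0$) are equivalent if and only if either $(c',r',s')=(c,r,s)$, or $$c'=-\frac{(sc-r)^2+1}{c},\qquad r'=-r,\qquad s'=\frac{sc^2}{(sc-r)^2+1}.$$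
   Context: Brackets of basis vectors not listed (and not obtained by antisymmetry) are zero. A complex structure on a real Lie algebra $\mathfrak{g}$ is a linear map $J:\mathfrak{g}\to\mathfrak{g}$ with $J^2=-1$ and $[JX,JY]-[X,Y]-J[JX,Y]-J[X,JY]=0$ for all $X,Y\in\mathfrak{g}$. $J$ is identified with its $6\times 6$ matrix $(\xi^k_j)$ ($k$ the row index, $j$ the column index) in the basis $(x_j)$, i.e. $Jx_j=\sum_k\xi^k_j x_k$; so the set of complex structures is a subset of $\mathbb{R}^{36}$. "Submanifold" means smooth ($C^\infty$) submanifold. $\mathrm{Aut}(\mathfrak{g})$ acts on complex structures by $J\mapsto\Phi^{-1}J\Phi$, and two complex structures are equivalent if they lie in the same orbit. $\mathrm{diag}$ denotes a block-diagonal matrix. *)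

theory Defs
  imports "HOL-Analysis.Analysis"
begin

text \<open>Both predicates on maps are meant for open sets, where the derivative \<open>at x\<close> only
  depends on the map near \<open>x\<close>.\<close>

primrec Ck_on :: "nat \<Rightarrow> ('a::euclidean_space \<Rightarrow> 'b::euclidean_space) \<Rightarrow> 'a set \<Rightarrow> bool" where
  "Ck_on 0 f U \<longleftrightarrow> continuous_on U f"
| "Ck_on (Suc k) f U \<longleftrightarrow> (\<forall>x\<in>U. f differentiable (at x)) \<and>
     (\<forall>v. Ck_on k (\<lambda>x. frechet_derivative f (at x) v) U)"

definition smooth_on :: "('a::euclidean_space \<Rightarrow> 'b::euclidean_space) \<Rightarrow> 'a set \<Rightarrow> bool" where
  "smooth_on f U \<longleftrightarrow> (\<forall>k. Ck_on k f U)"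

definition smooth_diffeomorphism ::
    "'a::euclidean_space set \<Rightarrow> 'b::euclidean_space set \<Rightarrow> ('a \<Rightarrow> 'b) \<Rightarrow> ('b \<Rightarrow> 'a) \<Rightarrow> bool" where
  "smooth_diffeomorphism U V \<phi> \<psi> \<longleftrightarrow>
     open U \<and> open V \<and> homeomorphism U V \<phi> \<psi> \<and> smooth_on \<phi> U \<and> smooth_on \<psi> V"

text \<open>Embedded submanifolds, by slice charts; a \<open>d\<close>-dimensional linear subspace \<open>L\<close> plays the
  role of \<open>\<real>\<^sup>d \<times> 0\<close>.\<close>

definition smooth_submanifold :: "nat \<Rightarrow> 'a::euclidean_space set \<Rightarrow> bool" where
  "smooth_submanifold d M \<longleftrightarrow>
     (\<forall>p\<in>M. \<exists>U (V :: 'a set) \<phi> \<psi> L. p \<in> U \<and> smooth_diffeomorphism U V \<phi> \<psi> \<and>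
        subspace L \<and> dim L = d \<and> \<phi> ` (U \<inter> M) = V \<inter> L)"

definition lie_bracket :: "('a::real_vector \<Rightarrow> 'a \<Rightarrow> 'a) \<Rightarrow> bool" where
  "lie_bracket br \<longleftrightarrow> bilinear br \<and> (\<forall>x. br x x = 0) \<and>
     (\<forall>x y z. br x (br y z) + br y (br z x) + br z (br x y) = 0)"

definition complex_structure :: "('a::real_vector \<Rightarrow> 'a \<Rightarrow> 'a) \<Rightarrow> ('a \<Rightarrow> 'a) \<Rightarrow> bool" where
  "complex_structure br J \<longleftrightarrow> linear J \<and> (\<forall>x. J (J x) = - x) \<and>
     (\<forall>x y. br (J x) (J y) - br x y - J (br (J x) y) - J (br x (J y)) = 0)"

definition lie_automorphism :: "('a::real_vector \<Rightarrow> 'a \<Rightarrow> 'a) \<Rightarrow> ('a \<Rightarrow> 'a) \<Rightarrow> bool" where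
  "lie_automorphism br \<Phi> \<longleftrightarrow> linear \<Phi> \<and> bij \<Phi> \<and> (\<forall>x y. \<Phi> (br x y) = br (\<Phi> x) (\<Phi> y))"

definition equivalent_cs :: "('a::real_vector \<Rightarrow> 'a \<Rightarrow> 'a) \<Rightarrow> ('a \<Rightarrow> 'a) \<Rightarrow> ('a \<Rightarrow> 'a) \<Rightarrow> bool" where
  "equivalent_cs br J J' \<longleftrightarrow> complex_structure br J \<and> complex_structure br J' \<and>
     (\<exists>\<Phi>. lie_automorphism br \<Phi> \<and> J' = inv \<Phi> \<circ> J \<circ> \<Phi>)"

text \<open>The entry \<open>A $ k $ j\<close> is in row \<open>k\<close> and column \<open>j\<close>, and column \<open>j\<close> is the image of the
  \<open>j\<close>-th basis vector.\<close>

definition complex_structure_matrices ::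
    "(real^'n \<Rightarrow> real^'n \<Rightarrow> real^'n) \<Rightarrow> (real^'n^'n) set" where
  "complex_structure_matrices br = {A. complex_structure br ((*v) A)}"

text \<open>The basis vector \<open>x\<^sub>i\<close> is \<open>axis i 1\<close>. In the type \<open>6\<close> the numeral \<open>6\<close> denotes the
  same element as \<open>0\<close>, so \<open>1, \<dots>, 6\<close> enumerate the type.\<close>

definition bracket_G65 :: "real^6 \<Rightarrow> real^6 \<Rightarrow> real^6" where
  "bracket_G65 x y =
     (x$1 * y$2 - x$2 * y$1) *\<^sub>R axis 4 1 +
     (x$1 * y$4 - x$4 * y$1) *\<^sub>R axis 5 1 +
     ((x$2 * y$3 - x$3 * y$2) + (x$2 * y$4 - x$4 * y$2)) *\<^sub>R axis 6 1"

definition J_G65 :: "real \<Rightarrow> real \<Rightarrow> real \<Rightarrow> real^6^6" where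
  "J_G65 c r s = (let a = - ((r^2 + 1 - s*r*c) / (s*c)); b = - (r + c - s*c) in
     vector
      [vector [a, - (a^2 + 1), 0, 0,               0, 0],
       vector [1, - a,         0, 0,               0, 0],
       vector [0, 0,           b, - ((b^2 + 1)/c), 0, 0],
       vector [0, 0,           c, - b,             0, 0],
       vector [0, 0,           0, 0,               r, - ((r^2 + 1)/s)],
       vector [0, 0,           0, 0,               s, - r]])"

lemma exhaust_6:
  fixes x :: 6
  shows "x = 1 \<or> x = 2 \<or> x = 3 \<or> x = 4 \<or> x = 5 \<or> x = 6"
proof (induct x)
  case (of_int z)
  then have "0 \<le> z" and "z < 6" by simp_all
  then have "z = 0 \<or> z = 1 \<or> z = 2 \<or> z = 3 \<or> z = 4 \<or> z = 5" by arith
  then show ?case by auto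
qed

lemma forall_6: "(\<forall>i::6. P i) \<longleftrightarrow> P 1 \<and> P 2 \<and> P 3 \<and> P 4 \<and> P 5 \<and> P 6"
  by (metis exhaust_6)

lemma UNIV_6: "UNIV = {1, 2, 3, 4, 5, 6::6}"
  using exhaust_6 by auto

lemma vector_6 [simp]:
  "(vector [p, q, t, u, v, w] :: ('a::zero)^6) $ 1 = p"
  "(vector [p, q, t, u, v, w] :: ('a::zero)^6) $ 2 = q"
  "(vector [p, q, t, u, v, w] :: ('a::zero)^6) $ 3 = t"
  "(vector [p, q, t, u, v, w] :: ('a::zero)^6) $ 4 = u"
  "(vector [p, q, t, u, v, w] :: ('a::zero)^6) $ 5 = v"
  "(vector [p, q, t, u, v, w] :: ('a::zero)^6) $ 6 = w"
  by (simp_all add: vector_def)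

lemma bracket_G65_basis:
  fixes x :: "6 \<Rightarrow> real^6"
  defines "x \<equiv> \<lambda>i. axis i 1"
  shows "bracket_G65 (x 1) (x 2) = x 4" "bracket_G65 (x 1) (x 4) = x 5"
    and "bracket_G65 (x 2) (x 3) = x 6" "bracket_G65 (x 2) (x 4) = x 6"
    and "bracket_G65 (x i) (x j) = - bracket_G65 (x j) (x i)"
    and "{i, j} \<notin> {{1, 2}, {1, 4}, {2, 3}, {2, 4}} \<Longrightarrow> bracket_G65 (x i) (x j) = 0"
proof -
  show "{i, j} \<notin> {{1, 2}, {1, 4}, {2, 3}, {2, 4}} \<Longrightarrow> bracket_G65 (x i) (x j) = 0"
    using exhaust_6[of i] exhaust_6[of j]
    by (elim disjE) (simp_all add: x_def bracket_G65_def axis_def insert_commute)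
qed (simp_all add: x_def bracket_G65_def axis_def vec_eq_iff algebra_simps)

lemma lie_bracket_G65: "lie_bracket bracket_G65"
  unfolding lie_bracket_def bilinear_def bracket_G65_def
  by (auto simp: linear_iff vec_eq_iff forall_6 axis_def algebra_simps)

end

(* A complex structure J preserves the upper central series Z = <x5, x6>, Z2 = <x3, ..., x6>, so its
   matrix is lower block triangular with 2 x 2 blocks. Since Z2 and Z are complex subspaces, the torsion
   N(X, Y) = [JX, JY] - [X, Y] - J[JX, Y] - J[X, JY], which is antisymmetric and satisfies
   N(X, JY) = -J N(X, Y), vanishes as soon as N(x1, x3) = 0. This single equation determines the block on
   Z as a rational function of the two others, and J^2 = -1 determines the even columns from the
   odd ones. Hence the complex structures are the graph of a rational map in the remaining 10 entries:
   the first column and the last four entries of the third.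

   For the orbits: starting from y1 = x1, y2 = J x1 - a x1, the bracket relations and J produce a basis in
   which J has the normal form. Automorphisms act on the span of x1, x2 modulo Z2 by diagonal or antidiagonal
   matrices, because x3 and x3 - x4 span the two directions of Z2/Z on which the bracket with g/Z2 has
   rank one; comparing entries in the two cases gives the two alternatives for equivalence. *)

theory Submission
  imports Defs
begin

section \<open>Smooth maps and graphs\<close>

text \<open>\<open>frechet_derivative\<close> is a choice operator, but functions that agree on the
  open set \<open>U\<close> share their derivatives there, so the induction can pass from the
  functions to their derivatives.\<close>

lemma Ck_on_cong:
  assumes "open U" "Ck_on k f U" "\<And>x. x \<in> U \<Longrightarrow> f x = g x"
  shows "Ck_on k g U"
  using assms(2,3)
proof (induction k arbitrary: f g)
  case 0
  then show ?case
    by (auto cong: continuous_on_cong)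
next
  case (Suc k)
  have D: "(g has_derivative frechet_derivative f (at x)) (at x)" if "x \<in> U" for x
    using Suc.prems that \<open>open U\<close>
    by (metis Ck_on.simps(2) frechet_derivative_works has_derivative_transform_within_open)
  have "frechet_derivative f (at x) = frechet_derivative g (at x)" if "x \<in> U" for x
    using D[OF that] by (rule frechet_derivative_at)
  then have "Ck_on k (\<lambda>x. frechet_derivative g (at x) v) U" for v
    using Suc.IH[of "\<lambda>x. frechet_derivative f (at x) v"] Suc.prems(1) by simp
  with D show ?case
    by (auto simp: differentiable_def)
qed

text \<open>Derivatives are unique, so an explicit formula \<open>f'\<close> may replace the chosen
  one. The inductive closure rules for sums, linear images, products and inverses take their step
  through this rule.\<close>

lemma Ck_on_SucI:
  assumes "open U" "\<And>x. x \<in> U \<Longrightarrow> (f has_derivative f' x) (at x)"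
    and "\<And>v. Ck_on k (\<lambda>x. f' x v) U"
  shows "Ck_on (Suc k) f U"
proof -
  have "f' x = frechet_derivative f (at x)" if "x \<in> U" for x
    using assms(2)[OF that] by (rule frechet_derivative_at)
  then have "Ck_on k (\<lambda>x. frechet_derivative f (at x) v) U" for v
    using Ck_on_cong[OF \<open>open U\<close> assms(3)[of v]] by simp
  with assms(2) show ?thesis
    by (auto simp: differentiable_def)
qed

lemma Ck_on_Suc_has_derivative:
  "Ck_on (Suc k) f U \<Longrightarrow> x \<in> U \<Longrightarrow> (f has_derivative frechet_derivative f (at x)) (at x)"
  using frechet_derivative_works by auto

lemma Ck_on_Suc_imp: "Ck_on (Suc k) f U \<Longrightarrow> Ck_on k f U"
proof (induction k arbitrary: f)
  case 0
  then show ?case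
    by (auto intro!: continuous_at_imp_continuous_on differentiable_imp_continuous_within)
next
  case (Suc k)
  then show ?case
    by (metis Ck_on.simps(2))
qed

lemma Ck_on_const: "Ck_on k (\<lambda>x. w) U"
  by (induction k arbitrary: w) (auto simp: frechet_derivative_const)

lemma Ck_on_bounded_linear:
  assumes "bounded_linear f" "open U"
  shows "Ck_on k f U"
proof (cases k)
  case 0
  with assms show ?thesis
    by (simp add: linear_continuous_on)
next
  case (Suc k')
  show ?thesis unfolding Suc
    by (rule Ck_on_SucI[OF \<open>open U\<close> bounded_linear_imp_has_derivative[OF assms(1)] Ck_on_const])
qed

lemma Ck_on_add:
  assumes "open U" "Ck_on k f U" "Ck_on k g U"
  shows "Ck_on k (\<lambda>x. f x + g x) U"
  using assms(2,3)
proof (induction k arbitrary: f g)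
  case 0
  then show ?case by (simp add: continuous_on_add)
next
  case (Suc k)
  show ?case
  proof (rule Ck_on_SucI[OF \<open>open U\<close>])
    show "((\<lambda>x. f x + g x) has_derivative
        (\<lambda>v. frechet_derivative f (at x) v + frechet_derivative g (at x) v)) (at x)"
      if "x \<in> U" for x
      using Suc.prems that by (intro has_derivative_add Ck_on_Suc_has_derivative)
  qed (use Suc in simp)
qed

lemma Ck_on_linear_image:
  assumes "open U" "bounded_linear L" "Ck_on k f U"
  shows "Ck_on k (\<lambda>x. L (f x)) U"
  using assms(3)
proof (induction k arbitrary: f)
  case 0
  then show ?case
    by (simp add: bounded_linear.continuous_on[OF assms(2)])
next
  case (Suc k)
  show ?case
  proof (rule Ck_on_SucI[OF \<open>open U\<close>])
    show "((\<lambda>x. L (f x)) has_derivative (\<lambda>v. L (frechet_derivative f (at x) v))) (at x)"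
      if "x \<in> U" for x
      using Suc.prems that
      by (intro bounded_linear.has_derivative[OF assms(2)] Ck_on_Suc_has_derivative)
  qed (use Suc in simp)
qed

text \<open>The product rule leaves one factor undifferentiated, which is then needed at the lower
  level \<open>k\<close>; this is where \<open>Ck_on_Suc_imp\<close> enters. Both factors vary in
  the induction, since each is in turn replaced by its derivative.\<close>

lemma Ck_on_scaleR:
  fixes f :: "'a::euclidean_space \<Rightarrow> real" and g :: "'a \<Rightarrow> 'b::euclidean_space"
  assumes "open U" "Ck_on k f U" "Ck_on k g U"
  shows "Ck_on k (\<lambda>x. f x *\<^sub>R g x) U"
  using assms(2,3)
proof (induction k arbitrary: f g)
  case 0
  then show ?case by (simp add: continuous_on_scaleR)
next
  case (Suc k)
  show ?case
  proof (rule Ck_on_SucI[OF \<open>open U\<close>])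
    show "((\<lambda>x. f x *\<^sub>R g x) has_derivative
        (\<lambda>v. f x *\<^sub>R frechet_derivative g (at x) v + frechet_derivative f (at x) v *\<^sub>R g x)) (at x)"
      if "x \<in> U" for x
      using Suc.prems that by (intro has_derivative_scaleR Ck_on_Suc_has_derivative)
    show "Ck_on k (\<lambda>x. f x *\<^sub>R frechet_derivative g (at x) v
        + frechet_derivative f (at x) v *\<^sub>R g x) U" for v
      using Suc.prems Ck_on_Suc_imp[OF Suc.prems(1)] Ck_on_Suc_imp[OF Suc.prems(2)]
      by (intro Ck_on_add Suc.IH \<open>open U\<close>) auto
  qed
qed

lemma Ck_on_mult:
  fixes f g :: "'a::euclidean_space \<Rightarrow> real"
  assumes "open U" "Ck_on k f U" "Ck_on k g U"
  shows "Ck_on k (\<lambda>x. f x * g x) U"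
  using Ck_on_scaleR[OF assms] by simp

text \<open>The derivative is a product of \<open>inverse (f x)\<close>, twice, and the derivative
  of \<open>f\<close>. The inverse is that of the same \<open>f\<close>, so the induction runs with
  \<open>f\<close> fixed.\<close>

lemma Ck_on_inverse:
  fixes f :: "'a::euclidean_space \<Rightarrow> real"
  assumes "open U" "Ck_on k f U" "\<And>x. x \<in> U \<Longrightarrow> f x \<noteq> 0"
  shows "Ck_on k (\<lambda>x. inverse (f x)) U"
  using assms(2)
proof (induction k)
  case 0
  with assms(3) show ?case by (simp add: continuous_on_inverse)
next
  case (Suc k)
  show ?case
  proof (rule Ck_on_SucI[OF \<open>open U\<close>])
    show "((\<lambda>x. inverse (f x)) has_derivative
        (\<lambda>v. (-1) * (inverse (f x) * frechet_derivative f (at x) v * inverse (f x)))) (at x)"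
      if "x \<in> U" for x
      using Deriv.has_derivative_inverse[OF assms(3)[OF that] Ck_on_Suc_has_derivative[OF Suc.prems that]]
      by simp
    show "Ck_on k (\<lambda>x. (-1) * (inverse (f x) * frechet_derivative f (at x) v * inverse (f x))) U" for v
      using Suc.prems Suc.IH[OF Ck_on_Suc_imp[OF Suc.prems]]
      by (intro Ck_on_mult Ck_on_const \<open>open U\<close>) auto
  qed
qed

section \<open>Smoothness of rational expressions\<close>

lemma smooth_on_const: "smooth_on (\<lambda>x. w) U"
  by (simp add: smooth_on_def Ck_on_const)

lemma smooth_on_linear: "linear f \<Longrightarrow> open U \<Longrightarrow> smooth_on f U"
  by (simp add: smooth_on_def Ck_on_bounded_linear linear_conv_bounded_linear)

lemma smooth_on_linear_image:
  "open U \<Longrightarrow> linear L \<Longrightarrow> smooth_on f U \<Longrightarrow> smooth_on (\<lambda>x. L (f x)) U"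
  by (simp add: smooth_on_def Ck_on_linear_image linear_conv_bounded_linear)

lemma smooth_on_add:
  "open U \<Longrightarrow> smooth_on f U \<Longrightarrow> smooth_on g U \<Longrightarrow> smooth_on (\<lambda>x. f x + g x) U"
  by (simp add: smooth_on_def Ck_on_add)

lemma smooth_on_minus: "open U \<Longrightarrow> smooth_on f U \<Longrightarrow> smooth_on (\<lambda>x. - f x) U"
  using smooth_on_linear_image[where L = uminus] by (simp add: linear_iff)

lemma smooth_on_diff:
  "open U \<Longrightarrow> smooth_on f U \<Longrightarrow> smooth_on g U \<Longrightarrow> smooth_on (\<lambda>x. f x - g x) U"
  using smooth_on_add[OF _ _ smooth_on_minus, of U f g] by simp

lemma smooth_on_scaleR:
  "open U \<Longrightarrow> smooth_on f U \<Longrightarrow> smooth_on g U \<Longrightarrow> smooth_on (\<lambda>x. f x *\<^sub>R g x) U"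
  by (simp add: smooth_on_def Ck_on_scaleR)

lemma smooth_on_mult:
  fixes f g :: "'a::euclidean_space \<Rightarrow> real"
  shows "open U \<Longrightarrow> smooth_on f U \<Longrightarrow> smooth_on g U \<Longrightarrow> smooth_on (\<lambda>x. f x * g x) U"
  by (simp add: smooth_on_def Ck_on_mult)

lemma smooth_on_divide:
  fixes f g :: "'a::euclidean_space \<Rightarrow> real"
  shows "open U \<Longrightarrow> smooth_on f U \<Longrightarrow> smooth_on g U \<Longrightarrow> (\<And>x. x \<in> U \<Longrightarrow> g x \<noteq> 0) \<Longrightarrow>
    smooth_on (\<lambda>x. f x / g x) U"
  by (simp add: smooth_on_def divide_inverse Ck_on_mult Ck_on_inverse)

lemma smooth_on_imp_continuous_on: "smooth_on f U \<Longrightarrow> continuous_on U f"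
  by (metis Ck_on.simps(1) smooth_on_def)

text \<open>\<open>M\<close> is the graph of \<open>F\<close> over the range of the projection
  \<open>P\<close>, and the shear that subtracts \<open>F\<close> flattens it. Since
  \<open>F\<close> sees only \<open>P x\<close> and takes values in the kernel of \<open>P\<close>,
  the shear leaves \<open>F\<close> unchanged, so adding \<open>F\<close> is its smooth inverse on
  the same \<open>U\<close>.\<close>

lemma smooth_submanifold_graph:
  fixes P F :: "'a::euclidean_space \<Rightarrow> 'a"
  assumes P: "linear P" "\<And>x. P (P x) = P x"
    and U: "open U" "\<And>x. P x \<in> U \<longleftrightarrow> x \<in> U"
    and F: "smooth_on F U" "\<And>x. F (P x) = F x" "\<And>x. P (F x) = 0"
    and M: "\<And>x. x \<in> M \<longleftrightarrow> x \<in> U \<and> x = P x + F x"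
  shows "smooth_submanifold (dim (range P)) M"
proof -
  let ?\<phi> = "\<lambda>x. x - F x" and ?\<psi> = "\<lambda>x. x + F x"
  have P\<phi>: "P (?\<phi> x) = P x" "P (?\<psi> x) = P x" for x
    using F(3) by (simp_all add: linear_diff[OF P(1)] linear_add[OF P(1)])
  have F\<phi>: "F (?\<phi> x) = F x" "F (?\<psi> x) = F x" for x
    using F(2) P\<phi> by metis+
  have mem: "?\<phi> x \<in> U \<longleftrightarrow> x \<in> U" "?\<psi> x \<in> U \<longleftrightarrow> x \<in> U" for x
    using U(2) P\<phi> by metis+
  have smooth: "smooth_on ?\<phi> U" "smooth_on ?\<psi> U"
    using smooth_on_diff[OF U(1) smooth_on_linear[OF linear_ident U(1)] F(1)]
      smooth_on_add[OF U(1) smooth_on_linear[OF linear_ident U(1)] F(1)] by simp_all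
  have "homeomorphism U U ?\<phi> ?\<psi>"
  proof (rule homeomorphismI)
    show "continuous_on U ?\<phi>" "continuous_on U ?\<psi>"
      using smooth by (auto intro: smooth_on_imp_continuous_on)
  qed (auto simp: mem F\<phi>)
  then have diffeo: "smooth_diffeomorphism U U ?\<phi> ?\<psi>"
    using U(1) smooth by (simp add: smooth_diffeomorphism_def)
  have im: "?\<phi> ` (U \<inter> M) = U \<inter> range P"
  proof (intro equalityI subsetI)
    fix y assume "y \<in> ?\<phi> ` (U \<inter> M)"
    then obtain x where x: "x \<in> U" "x = P x + F x" "y = x - F x"
      using M by blast
    then have "y = P x"
      by (metis add_diff_cancel_right')
    then show "y \<in> U \<inter> range P"
      using U(2) x(1) by simp
  next
    fix y assume "y \<in> U \<inter> range P"
    then obtain x where x: "y = P x" "y \<in> U" by blast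
    then have "?\<psi> y \<in> U \<inter> M"
      using mem(2) P\<phi>(2) F\<phi>(2) P(2) by (simp add: M)
    moreover have "y = ?\<phi> (?\<psi> y)"
      using F\<phi>(2) by simp
    ultimately show "y \<in> ?\<phi> ` (U \<inter> M)" by blast
  qed
  show ?thesis
    unfolding smooth_submanifold_def
    using diffeo im M linear_subspace_image[OF P(1) subspace_UNIV] by blast
qed

section \<open>Invariant subspaces\<close>

lemma bracket_G65_nth [simp]:
  "bracket_G65 x y $ 1 = 0" "bracket_G65 x y $ 2 = 0" "bracket_G65 x y $ 3 = 0"
  "bracket_G65 x y $ 4 = x$1 * y$2 - x$2 * y$1"
  "bracket_G65 x y $ 5 = x$1 * y$4 - x$4 * y$1"
  "bracket_G65 x y $ 6 = (x$2 * y$3 - x$3 * y$2) + (x$2 * y$4 - x$4 * y$2)"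
  by (simp_all add: bracket_G65_def axis_def)

lemma vec6_eq_iff:
  fixes x y :: "'a^6"
  shows "x = y \<longleftrightarrow> x$1 = y$1 \<and> x$2 = y$2 \<and> x$3 = y$3 \<and> x$4 = y$4 \<and> x$5 = y$5 \<and> x$6 = y$6"
  by (simp add: vec_eq_iff forall_6)

abbreviation bas :: "6 \<Rightarrow> real^6" where "bas i \<equiv> axis i 1"

lemma bas_nth [simp]: "bas i $ j = (if j = i then 1 else 0)"
  by (simp add: axis_def)

lemma vec6_expand:
  "x = x$1 *\<^sub>R bas 1 + x$2 *\<^sub>R bas 2 + x$3 *\<^sub>R bas 3 + x$4 *\<^sub>R bas 4 + x$5 *\<^sub>R bas 5 + x$6 *\<^sub>R bas 6"
  by (simp add: vec6_eq_iff)

lemma linear_vec6_expand: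
  assumes "linear J"
  shows "J x = x$1 *\<^sub>R J (bas 1) + x$2 *\<^sub>R J (bas 2) + x$3 *\<^sub>R J (bas 3) + x$4 *\<^sub>R J (bas 4)
    + x$5 *\<^sub>R J (bas 5) + x$6 *\<^sub>R J (bas 6)"
  by (subst vec6_expand[of x]) (simp add: linear_add[OF assms] linear_scale[OF assms])

lemma bracket_G65_neg [simp]:
  "bracket_G65 (- x) y = - bracket_G65 x y"
  "bracket_G65 x (- y) = - bracket_G65 x y"
  by (simp_all add: vec6_eq_iff algebra_simps)

lemma bracket_G65_center:
  "z$1 = 0 \<Longrightarrow> z$2 = 0 \<Longrightarrow> z$3 = 0 \<Longrightarrow> z$4 = 0 \<Longrightarrow> bracket_G65 z x = 0"
  "z$1 = 0 \<Longrightarrow> z$2 = 0 \<Longrightarrow> z$3 = 0 \<Longrightarrow> z$4 = 0 \<Longrightarrow> bracket_G65 x z = 0"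
  by (simp_all add: vec6_eq_iff)

text \<open>A real eigenvalue would have square -1. Hence no line is invariant under
  \<open>J\<close>, which drives both invariance proofs below.\<close>

lemma sq_neg_imp_no_eigenvector:
  assumes J: "linear J" "\<And>x. J (J x) = - x" and "J u = \<mu> *\<^sub>R u"
  shows "u = (0 :: 'a::real_vector)"
proof -
  have eq: "- u = (\<mu> * \<mu>) *\<^sub>R u"
    using J(2)[of u] assms(3) by (simp add: linear_scale[OF J(1)])
  have "(\<mu> * \<mu> + 1) *\<^sub>R u = 0"
    unfolding scaleR_add_left eq[symmetric] by simp
  moreover have "\<mu> * \<mu> + 1 > 0"
    by (simp add: add_nonneg_pos)
  ultimately show ?thesis by simp
qed

lemma complex_structure_center:
  assumes "complex_structure bracket_G65 J" and z: "z$1 = 0" "z$2 = 0" "z$3 = 0" "z$4 = 0"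
  shows "J z $ 1 = 0" "J z $ 2 = 0" "J z $ 3 = 0" "J z $ 4 = 0"
proof -
  have lin: "linear J" and JJ: "\<And>x. J (J x) = - x"
    and N: "\<And>x y. bracket_G65 (J x) (J y) - bracket_G65 x y - J (bracket_G65 (J x) y)
      - J (bracket_G65 x (J y)) = 0"
    using assms(1) unfolding complex_structure_def by auto
  note no_eig = sq_neg_imp_no_eigenvector[OF lin JJ]
  \<comment> \<open>\<open>N(x, z) = 0\<close> says that \<open>D = [\<cdot>, J z]\<close> commutes with \<open>J\<close>, so the images of \<open>D\<close> and
    \<open>D\<^sup>2\<close> are \<open>J\<close>-invariant and cannot be lines.\<close>
  define w where "w = J z"
  define D where "D x = bracket_G65 x w" for x
  have DJ: "D (J x) = J (D x)" for x
    using N[of x z] by (simp add: w_def D_def bracket_G65_center z linear_0[OF lin])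
  have w12: "w$1 = 0 \<and> w$2 = 0"
  proof (rule ccontr)
    assume nz: "\<not> (w$1 = 0 \<and> w$2 = 0)"
    define u where "u = w$1 *\<^sub>R bas 5 + w$2 *\<^sub>R bas 6"
    have DD: "D (D x) = (x$2 * w$1 - x$1 * w$2) *\<^sub>R u" for x
      by (simp add: D_def u_def vec6_eq_iff algebra_simps)
    \<comment> \<open>Chosen so that the scalar in \<open>DD\<close> equals 1; commuting
      \<open>J\<close> past \<open>D\<close> twice then makes \<open>u\<close> an
      eigenvector.\<close>
    define x where "x = (if w$1 \<noteq> 0 then (1 / w$1) *\<^sub>R bas 2 else (- 1 / w$2) *\<^sub>R bas 1)"
    have "D (D x) = u"
      using nz unfolding DD by (auto simp: x_def)
    then have "J u = (J x$2 * w$1 - J x$1 * w$2) *\<^sub>R u"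
      using DD[of "J x"] by (simp add: DJ)
    then have "u = 0" by (rule no_eig)
    with nz show False by (simp add: u_def vec6_eq_iff)
  qed
  then have Dx: "D x = (x$1 * w$4) *\<^sub>R bas 5 + (x$2 * (w$3 + w$4)) *\<^sub>R bas 6" for x
    by (simp add: D_def vec6_eq_iff algebra_simps)
  have D1: "D (bas 1) = w$4 *\<^sub>R bas 5" and D2: "D (bas 2) = (w$3 + w$4) *\<^sub>R bas 6"
    by (simp_all add: Dx)
  \<comment> \<open>If one of the two coefficients of \<open>Dx\<close> vanishes, the other must
    vanish too, as otherwise x5 or x6 spans an invariant line. If neither does, the image of
    \<open>D\<close> is the whole center, which is therefore invariant and contains
    \<open>w = J z\<close>.\<close>
  have w34: "w$3 = 0 \<and> w$4 = 0"
  proof (cases "w$4 = 0 \<or> w$3 + w$4 = 0")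
    case True
    have no56: "J (bas i) \<noteq> \<mu> *\<^sub>R bas i" for i \<mu>
      using no_eig[of "bas i" \<mu>] by auto
    have 5: "w$4 *\<^sub>R J (bas 5) = w$4 *\<^sub>R (J (bas 1) $ 1 *\<^sub>R bas 5)" if "w$3 + w$4 = 0"
      using DJ[of "bas 1"] that by (simp add: D1 linear_scale[OF lin] Dx mult.commute)
    have 6: "(w$3 + w$4) *\<^sub>R J (bas 6) = (w$3 + w$4) *\<^sub>R (J (bas 2) $ 2 *\<^sub>R bas 6)"
      if "w$4 = 0"
      using DJ[of "bas 2"] that by (simp add: D2 linear_scale[OF lin] Dx mult.commute)
    show ?thesis
      using True
    proof
      assume "w$4 = 0"
      with 6 no56 show ?thesis
        unfolding scaleR_cancel_left by auto
    next
      assume "w$3 + w$4 = 0"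
      with 5 no56 show ?thesis
        unfolding scaleR_cancel_left by auto
    qed
  next
    case False
    have JD: "J (D (bas i)) $ k = 0" if "k \<in> {1,2,3,4}" for i k
      unfolding DJ[symmetric] unfolding Dx using that by auto
    have "J (bas 5) $ k = 0" "J (bas 6) $ k = 0" if "k \<in> {1,2,3,4}" for k
      using JD[OF that, of 1] JD[OF that, of 2] False
      unfolding D1 D2 linear_scale[OF lin] by auto
    moreover have "w = z$5 *\<^sub>R J (bas 5) + z$6 *\<^sub>R J (bas 6)"
      using linear_vec6_expand[OF lin, of z] by (simp add: z w_def)
    ultimately show ?thesis by simp
  qed
  show "J z $ 1 = 0" "J z $ 2 = 0" "J z $ 3 = 0" "J z $ 4 = 0"
    using w12 w34 by (auto simp: w_def)
qed

lemma complex_structure_second_center: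
  assumes "complex_structure bracket_G65 J" and y: "y$1 = 0" "y$2 = 0"
  shows "J y $ 1 = 0" "J y $ 2 = 0"
proof -
  have lin: "linear J" and JJ: "\<And>x. J (J x) = - x"
    and N: "\<And>x y. bracket_G65 (J x) (J y) - bracket_G65 x y - J (bracket_G65 (J x) y)
      - J (bracket_G65 x (J y)) = 0"
    using assms(1) unfolding complex_structure_def by auto
  note center = complex_structure_center[OF assms(1)]
  \<comment> \<open>Modulo the center, \<open>N(x, y) = 0\<close> makes \<open>x\<^sub>4\<close> an eigenvector of \<open>J\<close> unless the claim holds.\<close>
  define w where "w = J y"
  have "w$1 = 0 \<and> w$2 = 0"
  proof (rule ccontr)
    assume nz: "\<not> (w$1 = 0 \<and> w$2 = 0)"
    \<comment> \<open>Scaled so that the x4-coordinate of \<open>[x, w]\<close> is 1, that is,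
      \<open>[x, w]\<close> equals x4 modulo the center.\<close>
    define x where "x = (if w$1 \<noteq> 0 then (- 1 / w$1) *\<^sub>R bas 2 else (1 / w$2) *\<^sub>R bas 1)"
    have x4: "bracket_G65 x w $ 4 = 1"
      using nz by (auto simp: x_def)
    define z where "z = bracket_G65 x w - bas 4"
    have z: "z$1 = 0" "z$2 = 0" "z$3 = 0" "z$4 = 0"
      using x4 by (simp_all add: z_def)
    have xw: "bracket_G65 x w = bas 4 + z"
      by (simp add: z_def)
    have v: "J (bracket_G65 (J x) y) $ k = 0" if "k \<in> {1,2,3,4}" for k
      using that center[of "bracket_G65 (J x) y"] y by auto
    have b: "bracket_G65 x y $ k = 0" if "k \<in> {1,2,3,4}" for k
      using that y by auto
    define \<mu> where "\<mu> = bracket_G65 (J x) w $ 4"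
    have Jx: "J (bas 4) = bracket_G65 (J x) w - bracket_G65 x y - J (bracket_G65 (J x) y) - J z"
      using N[of x y] by (simp add: xw linear_add[OF lin] flip: w_def)
    \<comment> \<open>Brackets with \<open>y\<close> are central and \<open>J\<close> preserves the
      center, so modulo the center N(x, y) = 0 reads \<open>J x4 = \<mu> x4\<close>. Applying
      \<open>J\<close> again gives the impossible square.\<close>
    define z' where "z' = J (bas 4) - \<mu> *\<^sub>R bas 4"
    have z': "z'$1 = 0" "z'$2 = 0" "z'$3 = 0" "z'$4 = 0"
      using v b center[OF z] y by (simp_all add: z'_def Jx \<mu>_def)
    have J4: "J (bas 4) = \<mu> *\<^sub>R bas 4 + z'"
      by (simp add: z'_def)
    have "- bas 4 = J (\<mu> *\<^sub>R bas 4 + z')"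
      using JJ[of "bas 4"] unfolding J4 by simp
    also have "\<dots> = \<mu> *\<^sub>R (\<mu> *\<^sub>R bas 4 + z') + J z'"
      by (simp only: linear_add[OF lin] linear_scale[OF lin] J4)
    finally have "(- bas 4) $ 4 = (\<mu> *\<^sub>R (\<mu> *\<^sub>R bas 4 + z') + J z') $ 4"
      by simp
    then have "- 1 = \<mu> * \<mu>"
      using z' center[OF z'] by simp
    then show False
      using zero_le_square[of \<mu>] by linarith
  qed
  then show "J y $ 1 = 0" "J y $ 2 = 0"
    by (auto simp: w_def)
qed

text \<open>The triangular shape of \<open>J\<close> recovers x6 from \<open>J x5\<close>, then x4
  from \<open>J x3\<close>, then x2 from \<open>J x1\<close>. Any linear condition stable under
  \<open>J\<close> thus needs checking on x1, x3, x5 only; it is applied to \<open>J^2 = -1\<close>,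
  to the torsion and to intertwining maps.\<close>

lemma J_invariant_subspace_UNIV:
  assumes "subspace S" "\<And>x. x \<in> S \<Longrightarrow> J x \<in> S" "bas 1 \<in> S" "bas 3 \<in> S" "bas 5 \<in> S"
    and J1: "J (bas 1) $ 2 \<noteq> 0"
    and J3: "J (bas 3) $ 1 = 0" "J (bas 3) $ 2 = 0" "J (bas 3) $ 4 \<noteq> 0"
    and J5: "J (bas 5) $ 1 = 0" "J (bas 5) $ 2 = 0" "J (bas 5) $ 3 = 0" "J (bas 5) $ 4 = 0"
      "J (bas 5) $ 6 \<noteq> 0"
  shows "S = UNIV"
proof -
  note sub = subspace_add[OF assms(1)] subspace_diff[OF assms(1)] subspace_scale[OF assms(1)] assms(2)
  have "bas 6 = (1 / J (bas 5) $ 6) *\<^sub>R (J (bas 5) - J (bas 5) $ 5 *\<^sub>R bas 5)"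
    using J5 by (simp add: vec6_eq_iff)
  also have "\<dots> \<in> S"
    by (intro sub assms(3-5))
  finally have 6: "bas 6 \<in> S" .
  have "bas 4 = (1 / J (bas 3) $ 4) *\<^sub>R (J (bas 3) - J (bas 3) $ 3 *\<^sub>R bas 3
      - J (bas 3) $ 5 *\<^sub>R bas 5 - J (bas 3) $ 6 *\<^sub>R bas 6)"
    using J3 by (simp add: vec6_eq_iff)
  also have "\<dots> \<in> S"
    by (intro sub assms(3-5) 6)
  finally have 4: "bas 4 \<in> S" .
  have "bas 2 = (1 / J (bas 1) $ 2) *\<^sub>R (J (bas 1) - J (bas 1) $ 1 *\<^sub>R bas 1
      - J (bas 1) $ 3 *\<^sub>R bas 3 - J (bas 1) $ 4 *\<^sub>R bas 4
      - J (bas 1) $ 5 *\<^sub>R bas 5 - J (bas 1) $ 6 *\<^sub>R bas 6)"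
    using J1 by (simp add: vec6_eq_iff)
  also have "\<dots> \<in> S"
    by (intro sub assms(3-5) 4 6)
  finally have "bas 2 \<in> S" .
  then have "x \<in> S" for x
    by (subst vec6_expand[of x]) (intro sub assms(3-5) 4 6 \<open>bas 2 \<in> S\<close>)
  then show ?thesis by blast
qed

section \<open>The torsion equation\<close>

text \<open>N(x1, x3) = 0 is one linear equation in \<open>J x5\<close> and \<open>J x6\<close>, and
  applying \<open>J\<close> gives a second one. The system has determinant
  \<open>c * e * (q - a)\<close>; eliminating \<open>J x6\<close> leaves the formula for
  \<open>J x5\<close>. Conversely this formula gives back N(x1, x3) = 0, and the symmetries of N
  spread the vanishing to all pairs.\<close>

lemma complex_structure_G65_iff:
  fixes J :: "real^6 \<Rightarrow> real^6"
  defines "a \<equiv> J (bas 1) $ 1" and "e \<equiv> J (bas 1) $ 2"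
    and "b \<equiv> J (bas 3) $ 3" and "c \<equiv> J (bas 3) $ 4"
  defines "q \<equiv> b + c"
  shows "complex_structure bracket_G65 J \<longleftrightarrow>
    linear J \<and> e \<noteq> 0 \<and> c \<noteq> 0 \<and> q \<noteq> a \<and> J (bas 3) $ 1 = 0 \<and> J (bas 3) $ 2 = 0 \<and>
    J (bas 5) = ((a * q + 1) / (q - a)) *\<^sub>R bas 5 + (e * (q^2 + 1) / (c * (q - a))) *\<^sub>R bas 6 \<and>
    J (J (bas 1)) = - bas 1 \<and> J (J (bas 3)) = - bas 3 \<and> J (J (bas 5)) = - bas 5"
    (is "?L \<longleftrightarrow> ?R")
proof
  assume L: ?L
  have lin: "linear J" and JJ: "\<And>x. J (J x) = - x"
    and N: "\<And>x y. bracket_G65 (J x) (J y) - bracket_G65 x y - J (bracket_G65 (J x) y)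
      - J (bracket_G65 x (J y)) = 0"
    using L unfolding complex_structure_def by auto
  note center = complex_structure_center[OF L] and center2 = complex_structure_second_center[OF L]
  have J3: "J (bas 3) $ 1 = 0" "J (bas 3) $ 2 = 0"
    by (simp_all add: center2)
  have no_sq: "x * x \<noteq> - 1" for x :: real
    using zero_le_square[of x] by linarith
  have e: "e \<noteq> 0"
  proof
    assume "e = 0"
    then have "J (J (bas 1)) $ 1 = a * a"
      by (subst linear_vec6_expand[OF lin, of "J (bas 1)"]) (simp add: a_def e_def center2)
    then show False using no_sq[of a] by (simp add: JJ)
  qed
  have c: "c \<noteq> 0"
  proof
    assume "c = 0"
    then have "J (J (bas 3)) $ 3 = b * b"
      by (subst linear_vec6_expand[OF lin, of "J (bas 3)"]) (simp add: b_def c_def J3 center)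
    then show False using no_sq[of b] by (simp add: JJ)
  qed
  have br: "bracket_G65 (J (bas 1)) (J (bas 3)) = (a * c) *\<^sub>R bas 5 + (e * q) *\<^sub>R bas 6"
    "bracket_G65 (bas 1) (bas 3) = 0" "bracket_G65 (J (bas 1)) (bas 3) = e *\<^sub>R bas 6"
    "bracket_G65 (bas 1) (J (bas 3)) = c *\<^sub>R bas 5"
    by (simp_all add: vec6_eq_iff J3 a_def b_def c_def e_def q_def algebra_simps)
  have E1: "c *\<^sub>R J (bas 5) + e *\<^sub>R J (bas 6) = (a * c) *\<^sub>R bas 5 + (e * q) *\<^sub>R bas 6"
    using N[of "bas 1" "bas 3"] unfolding br by (simp add: linear_scale[OF lin] algebra_simps)
  have "J (c *\<^sub>R J (bas 5) + e *\<^sub>R J (bas 6)) = J ((a * c) *\<^sub>R bas 5 + (e * q) *\<^sub>R bas 6)"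
    using E1 by simp
  then have E2: "- c *\<^sub>R bas 5 - e *\<^sub>R bas 6 = (a * c) *\<^sub>R J (bas 5) + (e * q) *\<^sub>R J (bas 6)"
    by (simp add: linear_add[OF lin] linear_scale[OF lin] JJ)
  have E1k: "c * J (bas 5) $ k + e * J (bas 6) $ k = a * c * bas 5 $ k + e * q * bas 6 $ k" for k
    using arg_cong[OF E1, of "\<lambda>v. v $ k"] by simp
  have E2k: "- c * bas 5 $ k - e * bas 6 $ k = a * c * J (bas 5) $ k + e * q * J (bas 6) $ k" for k
    using arg_cong[OF E2, of "\<lambda>v. v $ k"] by simp
  \<comment> \<open>For \<open>q = a\<close> the x5-coordinate of the second equation has right side
    \<open>a\<close> times the left side of the first, which forces
    \<open>- c = a * a * c\<close>.\<close>
  have q: "q \<noteq> a"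
  proof
    assume "q = a"
    then have "- c = a * (c * J (bas 5) $ 5 + e * J (bas 6) $ 5)"
      using E2k[of 5] by (simp add: algebra_simps)
    also have "\<dots> = (a * a) * c"
      using E1k[of 5] by simp
    finally have "(a * a + 1) * c = 0"
      by (simp add: algebra_simps)
    with c no_sq[of a] show False
      by (simp add: eq_neg_iff_add_eq_0)
  qed
  \<comment> \<open>This is \<open>q\<close> times the first equation minus the second, so that
    \<open>J x6\<close> cancels.\<close>
  have c5: "J (bas 5) $ k * (c * (q - a)) = (a * c * q + c) * bas 5 $ k + e * (q^2 + 1) * bas 6 $ k" for k
  proof -
    have "J (bas 5) $ k * (c * (q - a)) = q * (c * J (bas 5) $ k + e * J (bas 6) $ k)
        - (a * c * J (bas 5) $ k + e * q * J (bas 6) $ k)"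
      by (simp add: algebra_simps)
    also have "\<dots> = (a * c * q + c) * bas 5 $ k + e * (q^2 + 1) * bas 6 $ k"
      unfolding E1k E2k[symmetric] by (simp add: algebra_simps power2_eq_square)
    finally show ?thesis .
  qed
  have J5k: "J (bas 5) $ k =
      ((a * c * q + c) * bas 5 $ k + e * (q^2 + 1) * bas 6 $ k) / (c * (q - a))" for k
    using c q c5 by (intro eq_divide_imp) auto
  have rr: "(a * c * q + c) / (c * (q - a)) = (a * q + 1) / (q - a)"
    using c q by (simp add: field_simps)
  have J5: "J (bas 5) = ((a * q + 1) / (q - a)) *\<^sub>R bas 5 + (e * (q^2 + 1) / (c * (q - a))) *\<^sub>R bas 6"
    by (simp add: vec6_eq_iff J5k rr)
  show ?R
    by (intro conjI lin e c q J3 J5 JJ)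
next
  assume R: ?R
  define r s where "r = (a * q + 1) / (q - a)" and "s = e * (q^2 + 1) / (c * (q - a))"
  have lin: "linear J" and nz: "e \<noteq> 0" "c \<noteq> 0" "q \<noteq> a"
    and J3: "J (bas 3) $ 1 = 0" "J (bas 3) $ 2 = 0"
    and J5: "J (bas 5) = r *\<^sub>R bas 5 + s *\<^sub>R bas 6"
    and JJ1: "J (J (bas 1)) = - bas 1" and JJ3: "J (J (bas 3)) = - bas 3"
    and JJ5: "J (J (bas 5)) = - bas 5"
    using R unfolding r_def s_def by blast+
  have q1: "q^2 + 1 \<noteq> 0"
    by (metis add_nonneg_pos less_irrefl zero_le_power2 zero_less_one)
  then have s: "s \<noteq> 0"
    using nz by (simp add: s_def)
  have UNIVI: "S = UNIV" if "subspace S" "\<And>x. x \<in> S \<Longrightarrow> J x \<in> S" "bas 1 \<in> S" "bas 3 \<in> S" "bas 5 \<in> S" for S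
    using that nz s J3 by (intro J_invariant_subspace_UNIV[of S J]) (simp_all add: J5 e_def c_def)
  have "{x. J (J x) = - x} = UNIV"
    by (rule UNIVI) (auto simp: subspace_def JJ1 JJ3 JJ5 linear_0[OF lin] linear_add[OF lin]
        linear_scale[OF lin] linear_neg[OF lin])
  then have JJ: "J (J x) = - x" for x by blast
  define N where "N x y = bracket_G65 (J x) (J y) - bracket_G65 x y - J (bracket_G65 (J x) y)
      - J (bracket_G65 x (J y))" for x y
  have bil: "bilinear bracket_G65"
    using lie_bracket_G65 by (simp add: lie_bracket_def)
  have anti: "bracket_G65 x y = - bracket_G65 y x" for x y
    by (simp add: vec6_eq_iff)
  have N_anti: "N x y = - N y x" for x y
    unfolding N_def
    by (subst (1 2 3 4) anti) (simp add: linear_neg[OF lin])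
  have N_J: "N x (J y) = - J (N x y)" for x y
    unfolding N_def
    by (simp add: JJ linear_neg[OF lin] linear_diff[OF lin])
  have N_add: "N x (y + z) = N x y + N x z" for x y z
    by (simp add: N_def linear_add[OF lin] bilinear_radd[OF bil])
  have N_scale: "N x (k *\<^sub>R y) = k *\<^sub>R N x y" for x y k
    by (simp add: N_def linear_scale[OF lin] bilinear_rmul[OF bil] scaleR_diff_right)
  have N_sub: "subspace {y. N x y = 0}" for x
    using N_scale[of x 0] by (simp add: subspace_def N_add N_scale)
  \<comment> \<open>By \<open>N_sub\<close> and \<open>N_J\<close> the zeros of \<open>N x\<close>
    form a \<open>J\<close>-invariant subspace, so three values decide.\<close>
  have N_UNIV: "N x y = 0" if "N x (bas 1) = 0" "N x (bas 3) = 0" "N x (bas 5) = 0" for x y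
  proof -
    have "{y. N x y = 0} = UNIV"
      by (rule UNIVI) (use N_sub that in \<open>simp_all add: N_J linear_0[OF lin]\<close>)
    then show ?thesis by blast
  qed
  have Nself: "N x x = 0" for x
    using N_anti[of x x] by (simp add: vec_eq_iff)
  have N5: "N x (bas 5) = 0" for x
    by (simp add: N_def J5 bracket_G65_center linear_0[OF lin])
  have J6: "J (bas 6) = (- (1 + r^2) / s) *\<^sub>R bas 5 + (- r) *\<^sub>R bas 6"
  proof -
    have "J (r *\<^sub>R bas 5 + s *\<^sub>R bas 6) = - bas 5"
      using JJ5 unfolding J5 .
    then have J56: "r *\<^sub>R J (bas 5) + s *\<^sub>R J (bas 6) = - bas 5"
      by (simp only: linear_add[OF lin] linear_scale[OF lin])
    have "r * J (bas 5) $ k + s * J (bas 6) $ k = - bas 5 $ k" for k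
      using arg_cong[OF J56, of "\<lambda>v. v $ k"] by simp
    then have J6k: "J (bas 6) $ k = (- bas 5 $ k - r * J (bas 5) $ k) / s" for k
      using s by (metis add_diff_cancel_left' nonzero_mult_div_cancel_left)
    show ?thesis
      using s by (simp add: vec6_eq_iff J6k J5 power2_eq_square)
  qed
  \<comment> \<open>\<open>eq5\<close> and \<open>eq6\<close> are the x5- and x6-coordinates of
    N(x1, x3) = 0. The first rests on the two-squares identity
    \<open>(q - a)^2 + (a * q + 1)^2 = (a^2 + 1) * (q^2 + 1)\<close>, which computes
    \<open>1 + r^2\<close>.\<close>
  have eq5: "a * c = c * r - e * (1 + r^2) / s"
  proof -
    have "1 + r^2 = ((q - a)^2 + (a * q + 1)^2) / (q - a)^2"
      unfolding r_def power_divide add_divide_distrib[of "_ ^ 2"] using nz by simp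
    also have "(q - a)^2 + (a * q + 1)^2 = (a^2 + 1) * (q^2 + 1)"
      by (simp add: power2_eq_square algebra_simps)
    finally have "1 + r^2 = (a^2 + 1) * (q^2 + 1) / (q - a)^2" .
    moreover have "e * ((a^2 + 1) * Q / d^2) / (e * Q / (c * d)) = c * (a^2 + 1) / d"
      if "Q \<noteq> 0" "d \<noteq> 0" for Q d
      using that nz by (simp add: power2_eq_square[of d])
    ultimately have es: "e * (1 + r^2) / s = c * (a^2 + 1) / (q - a)"
      using nz q1 by (simp add: s_def)
    have "c * r - c * (a^2 + 1) / (q - a) = a * c * (q - a) / (q - a)"
      unfolding r_def times_divide_eq_right diff_divide_distrib[symmetric]
      by (simp add: algebra_simps power2_eq_square)
    then show ?thesis
      unfolding es using nz by simp
  qed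
  have eq6: "e * q = c * s - e * r"
  proof -
    have "c * s = e * (q^2 + 1) / (q - a)"
      using nz by (simp add: s_def)
    then have "c * s - e * r = e * q * (q - a) / (q - a)"
      unfolding r_def times_divide_eq_right by (simp add: algebra_simps power2_eq_square flip: diff_divide_distrib)
    then show ?thesis
      using nz by simp
  qed
  have N13: "N (bas 1) (bas 3) = 0"
  proof -
    have br: "bracket_G65 (J (bas 1)) (J (bas 3)) = (a * c) *\<^sub>R bas 5 + (e * q) *\<^sub>R bas 6"
      "bracket_G65 (bas 1) (bas 3) = 0" "bracket_G65 (J (bas 1)) (bas 3) = e *\<^sub>R bas 6"
      "bracket_G65 (bas 1) (J (bas 3)) = c *\<^sub>R bas 5"
      by (simp_all add: vec6_eq_iff J3 a_def b_def c_def e_def q_def algebra_simps)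
    define t where "t = (1 + r^2) / s"
    have J6': "J (bas 6) = (- t) *\<^sub>R bas 5 + (- r) *\<^sub>R bas 6"
      unfolding J6 t_def minus_divide_left ..
    have eq5': "a * c = c * r - e * t"
      unfolding eq5 t_def by simp
    show ?thesis
      unfolding N_def br eq5' eq6
      by (simp add: linear_scale[OF lin] J5 J6' vec6_eq_iff)
  qed
  \<comment> \<open>Antisymmetry lets the fixed argument pass from x1 to x3 and then to an arbitrary
    vector.\<close>
  have N1: "N (bas 1) y = 0" for y
    by (rule N_UNIV) (simp_all add: Nself N13 N5)
  have N3: "N (bas 3) y = 0" for y
    by (rule N_UNIV) (simp_all add: Nself N_anti[of "bas 3" "bas 1"] N13 N5)
  have "N x y = 0" for x y
    by (rule N_UNIV) (simp_all add: N_anti[of x "bas 1"] N_anti[of x "bas 3"] N1 N3 N5)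
  then show ?L
    unfolding complex_structure_def N_def using lin JJ by blast
qed

section \<open>Normal forms\<close>

lemma lie_automorphism_equivalent_cs:
  assumes "complex_structure br J" "complex_structure br J'" "lie_automorphism br \<Phi>"
    and "\<And>x. \<Phi> (J' x) = J (\<Phi> x)"
  shows "equivalent_cs br J J'"
proof -
  have "inj \<Phi>"
    using assms(3) by (simp add: lie_automorphism_def bij_is_inj)
  then have "J' = inv \<Phi> \<circ> J \<circ> \<Phi>"
    by (simp add: fun_eq_iff flip: assms(4))
  with assms(1-3) show ?thesis
    unfolding equivalent_cs_def by blast
qed

text \<open>If the relation holds at \<open>y\<close>, it holds at \<open>J' y\<close>, because both
  structures square to -1. So the vectors where it holds form a \<open>J'\<close>-invariant
  subspace.\<close>

lemma intertwining_G65_I: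
  assumes J: "complex_structure bracket_G65 J" and J': "complex_structure bracket_G65 J'"
    and \<Phi>: "linear \<Phi>" "\<Phi> (J' (bas 1)) = J (\<Phi> (bas 1))" "\<Phi> (J' (bas 3)) = J (\<Phi> (bas 3))"
      "\<Phi> (J' (bas 5)) = J (\<Phi> (bas 5))"
  shows "\<Phi> (J' x) = J (\<Phi> x)"
proof -
  have lin: "linear J" "linear J'" and JJ: "\<And>x. J (J x) = - x" "\<And>x. J' (J' x) = - x"
    using J J' by (auto simp: complex_structure_def)
  define S where "S = {x. \<Phi> (J' x) = J (\<Phi> x)}"
  have sub: "subspace S"
    by (simp add: S_def subspace_def linear_0[OF \<Phi>(1)] linear_0[OF lin(1)] linear_0[OF lin(2)]
        linear_add[OF \<Phi>(1)] linear_add[OF lin(1)] linear_add[OF lin(2)]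
        linear_scale[OF \<Phi>(1)] linear_scale[OF lin(1)] linear_scale[OF lin(2)])
  have inv: "J' y \<in> S" if "y \<in> S" for y
    using that JJ by (simp add: S_def linear_neg[OF \<Phi>(1)])
  note iff = J'[unfolded complex_structure_G65_iff]
  have q1: "x^2 + 1 \<noteq> 0" for x :: real
    by (metis add_nonneg_pos less_irrefl zero_le_power2 zero_less_one)
  have "S = UNIV"
  proof (rule J_invariant_subspace_UNIV[where J = J'])
    show "bas 1 \<in> S" "bas 3 \<in> S" "bas 5 \<in> S"
      using \<Phi> by (auto simp: S_def)
    show "J' (bas 5) $ 6 \<noteq> 0"
      using iff q1[of "J' (bas 3) $ 3 + J' (bas 3) $ 4"] by simp
  qed (use sub inv iff complex_structure_center[OF J'] in auto)
  then show ?thesis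
    by (auto simp: S_def)
qed

lemma J_G65_basis:
  "J_G65 c r s *v bas 1 = (- ((r^2 + 1 - s*r*c) / (s*c))) *\<^sub>R bas 1 + bas 2"
  "J_G65 c r s *v bas 3 = (- (r + c - s*c)) *\<^sub>R bas 3 + c *\<^sub>R bas 4"
  "J_G65 c r s *v bas 5 = r *\<^sub>R bas 5 + s *\<^sub>R bas 6"
  "J_G65 c r s *v bas 2 = (- ((- ((r^2 + 1 - s*r*c) / (s*c)))^2 + 1)) *\<^sub>R bas 1
      - (- ((r^2 + 1 - s*r*c) / (s*c))) *\<^sub>R bas 2"
  "J_G65 c r s *v bas 4 = (- (((- (r + c - s*c))^2 + 1) / c)) *\<^sub>R bas 3 - (- (r + c - s*c)) *\<^sub>R bas 4"
  "J_G65 c r s *v bas 6 = (- ((r^2 + 1) / s)) *\<^sub>R bas 5 - r *\<^sub>R bas 6"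
  by (simp_all add: matrix_vector_mult_basis column_def J_G65_def Let_def vec6_eq_iff)

text \<open>This is the case \<open>e = 1\<close> of \<open>complex_structure_G65_iff\<close>. The
  expressions for \<open>a\<close> and \<open>b\<close> in terms of \<open>c\<close>,
  \<open>r\<close>, \<open>s\<close> invert the torsion formula, with
  \<open>q = s * c - r\<close>.\<close>

lemma complex_structure_J_G65:
  assumes "c * s \<noteq> 0"
  shows "complex_structure bracket_G65 ((*v) (J_G65 c r s))"
proof -
  define a b q where "a = - ((r^2 + 1 - s*r*c) / (s*c))" and "b = - (r + c - s*c)" and "q = b + c"
  have nz: "c \<noteq> 0" "s \<noteq> 0" using assms by auto
  note bas = J_G65_basis[of c r s, folded a_def b_def]
  have lin: "linear ((*v) (J_G65 c r s))" by (rule matrix_vector_mul_linear)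
  have q: "q = s * c - r"
    by (simp add: q_def b_def)
  have q1: "q^2 + 1 > 0"
    by (simp add: add_nonneg_pos)
  have sc: "s * c * (q - a) = q^2 + 1"
    using nz by (simp add: a_def q field_simps power2_eq_square)
  then have qa: "q \<noteq> a"
    using q1 by auto
  have "s * c * a = r * q - 1"
    using nz by (simp add: a_def q field_simps power2_eq_square)
  then have "r * (q - a) = a * q + 1"
    by (simp add: q algebra_simps)
  then have r: "r = (a * q + 1) / (q - a)"
    using qa by (simp add: eq_divide_imp)
  have "s * (c * (q - a)) = 1 * (q^2 + 1)"
    using sc by (simp add: mult.assoc)
  then have s: "s = 1 * (q^2 + 1) / (c * (q - a))"
    using nz qa by (simp add: eq_divide_imp)
  show ?thesis
    unfolding complex_structure_G65_iff
  proof (intro conjI lin)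
    let ?J = "(*v) (J_G65 c r s)"
    have "?J (bas 5) = ((a * q + 1) / (q - a)) *\<^sub>R bas 5 + (1 * (q^2 + 1) / (c * (q - a))) *\<^sub>R bas 6"
      unfolding bas r[symmetric] s[symmetric] ..
    then show "?J (bas 5) = ((?J (bas 1) $ 1 * (?J (bas 3) $ 3 + ?J (bas 3) $ 4) + 1)
        / (?J (bas 3) $ 3 + ?J (bas 3) $ 4 - ?J (bas 1) $ 1)) *\<^sub>R bas 5
      + (?J (bas 1) $ 2 * ((?J (bas 3) $ 3 + ?J (bas 3) $ 4)^2 + 1)
        / (?J (bas 3) $ 4 * (?J (bas 3) $ 3 + ?J (bas 3) $ 4 - ?J (bas 1) $ 1))) *\<^sub>R bas 6"
      unfolding bas by (simp add: q_def)
    show "?J (?J (bas 1)) = - bas 1" "?J (?J (bas 3)) = - bas 3" "?J (?J (bas 5)) = - bas 5"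
      using nz by (simp_all add: bas linear_add[OF lin] linear_scale[OF lin] vec6_eq_iff
          power2_eq_square field_simps)
  qed (use nz qa in \<open>simp_all add: bas q_def\<close>)
qed

lemma complex_structure_G65_normal_form:
  assumes J: "complex_structure bracket_G65 J"
  shows "\<exists>c r s. c * s \<noteq> 0 \<and> equivalent_cs bracket_G65 J ((*v) (J_G65 c r s))"
proof -
  define a e b c where "a = J (bas 1) $ 1" and "e = J (bas 1) $ 2"
    and "b = J (bas 3) $ 3" and "c = J (bas 3) $ 4"
  define q where "q = b + c"
  define r where "r = (a * q + 1) / (q - a)"
  \<comment> \<open>The x6-coordinate of \<open>J x5\<close> divided by \<open>e\<close>: the new
    basis vectors are \<open>e x5\<close> and \<open>e^2 x6\<close>, and the rescaling removes this
    factor.\<close>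
  define s where "s = (q^2 + 1) / (c * (q - a))"
  note iff = J[unfolded complex_structure_G65_iff, folded a_def e_def b_def c_def q_def]
  have lin: "linear J" and JJ: "\<And>x. J (J x) = - x"
    using J by (auto simp: complex_structure_def)
  have nz: "e \<noteq> 0" "c \<noteq> 0" "q \<noteq> a" and J3: "J (bas 3) $ 1 = 0" "J (bas 3) $ 2 = 0"
    using iff by blast+
  have "J (bas 5) = r *\<^sub>R bas 5 + (e * (q^2 + 1) / (c * (q - a))) *\<^sub>R bas 6"
    using iff unfolding r_def by blast
  then have J5: "J (bas 5) = r *\<^sub>R bas 5 + (e * s) *\<^sub>R bas 6"
    by (simp add: s_def)
  have q1: "x^2 + 1 \<noteq> 0" for x :: real
    by (metis add_nonneg_pos less_irrefl zero_le_power2 zero_less_one)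
  have s: "s \<noteq> 0"
    using nz q1 by (simp add: s_def)
  have sc: "s * c = (q^2 + 1) / (q - a)"
    using nz by (simp add: s_def)
  \<comment> \<open>\<open>r\<close> and \<open>s\<close> were built from \<open>a\<close>,
    \<open>b\<close>, \<open>c\<close>; this step and the next check that the normal form with these
    parameters returns the same \<open>b\<close> and \<open>a\<close>.\<close>
  have b: "- (r + c - s*c) = b"
  proof -
    have "s * c - r = (q * (q - a)) / (q - a)"
      unfolding sc r_def diff_divide_distrib[symmetric] by (simp add: algebra_simps power2_eq_square)
    also have "\<dots> = q"
      using nz by simp
    finally show ?thesis
      by (simp add: q_def)
  qed
  have a: "- ((r^2 + 1 - s*r*c) / (s*c)) = a"
  proof -
    have q: "s * c - r = q" using b by (simp add: q_def)
    have "r * (q - a) = a * q + 1"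
      using nz by (simp add: r_def)
    then have "a * (s * c) = - (r^2 + 1 - s * r * c)"
      by (simp add: algebra_simps power2_eq_square flip: q)
    then show ?thesis
      using nz s by (metis divide_eq_eq minus_divide_left mult_eq_0_iff)
  qed
  note basJ = J_G65_basis[of c r s, unfolded a b]
  \<comment> \<open>\<open>\<Phi>\<close> maps the basis to \<open>y\<^sub>1 = x\<^sub>1\<close>, \<open>y\<^sub>2 = J y\<^sub>1 - a y\<^sub>1\<close>, \<open>y\<^sub>4 = [y\<^sub>1, y\<^sub>2]\<close>, \<open>y\<^sub>3\<close> (here \<open>y\<close>) solving
    \<open>J y\<^sub>3 = b y\<^sub>3 + c y\<^sub>4\<close>, \<open>y\<^sub>5 = [y\<^sub>1, y\<^sub>4]\<close>, \<open>y\<^sub>6 = [y\<^sub>2, y\<^sub>4]\<close>.\<close>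
  define f where "f = J (bas 1)"
  \<comment> \<open>With y4 = \<open>[y1, y2]\<close>, the equation is
    \<open>(J - b) y3 = c y4\<close>. Since \<open>(J + b) (J - b) = - (b^2 + 1)\<close>, applying
    \<open>J + b\<close> solves it.\<close>
  define y where "y = (- c / (b^2 + 1)) *\<^sub>R (J (e *\<^sub>R bas 4 + f$4 *\<^sub>R bas 5) + b *\<^sub>R (e *\<^sub>R bas 4 + f$4 *\<^sub>R bas 5))"
  define \<Phi> :: "real^6 \<Rightarrow> real^6" where
    "\<Phi> x = vector [x$1, e * x$2, f$3 * x$2 + e * x$3, f$4 * x$2 + e * x$4,
      f$5 * x$2 + y$5 * x$3 + f$4 * x$4 + e * x$5, f$6 * x$2 + y$6 * x$3 + e^2 * x$6]" for x
  have lin\<Phi>: "linear \<Phi>"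
    by (simp add: linear_iff \<Phi>_def vec6_eq_iff algebra_simps)
  have "x = 0" if "\<Phi> x = 0" for x
    using that nz by (auto simp: \<Phi>_def vec6_eq_iff)
  then have "inj \<Phi>"
    by (simp add: linear_injective_0[OF lin\<Phi>])
  then have "bij \<Phi>"
    using linear_injective_imp_surjective[OF lin\<Phi>] by (simp add: bij_def)
  moreover have "\<Phi> (bracket_G65 x z) = bracket_G65 (\<Phi> x) (\<Phi> z)" for x z
    by (simp add: \<Phi>_def vec6_eq_iff algebra_simps power2_eq_square)
  ultimately have aut: "lie_automorphism bracket_G65 \<Phi>"
    using lin\<Phi> by (simp add: lie_automorphism_def)
  have \<Phi>1: "\<Phi> (bas 1) = bas 1" and \<Phi>5: "\<Phi> (bas 5) = e *\<^sub>R bas 5"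
    by (simp_all add: \<Phi>_def vec6_eq_iff)
  have \<Phi>2: "\<Phi> (bas 2) = J (bas 1) - a *\<^sub>R bas 1" and \<Phi>6: "\<Phi> (bas 6) = e^2 *\<^sub>R bas 6"
    by (simp_all add: \<Phi>_def vec6_eq_iff a_def e_def f_def)
  have \<Phi>4: "\<Phi> (bas 4) = e *\<^sub>R bas 4 + f$4 *\<^sub>R bas 5"
    by (simp add: \<Phi>_def vec6_eq_iff)
  \<comment> \<open>The definition of \<open>\<Phi>\<close> puts \<open>e\<close> and 0 for the x3-
    and x4-coordinates of \<open>y\<close>. They are confirmed here by reading
    \<open>J (J x3) = - x3\<close> in those two coordinates.\<close>
  have \<Phi>3: "\<Phi> (bas 3) = y"
  proof -
    have JJ3: "b *\<^sub>R J (bas 3) + c *\<^sub>R J (bas 4) + J (bas 3)$5 *\<^sub>R J (bas 5) + J (bas 3)$6 *\<^sub>R J (bas 6) = - bas 3"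
      using linear_vec6_expand[OF lin, of "J (bas 3)"] J3 JJ by (simp add: b_def c_def)
    note cen = complex_structure_center[OF J] complex_structure_second_center[OF J]
    have "b * b + c * J (bas 4)$3 = - 1" "b * c + c * J (bas 4)$4 = 0"
      using arg_cong[OF JJ3, of "\<lambda>v. v$3"] arg_cong[OF JJ3, of "\<lambda>v. v$4"]
      by (simp_all add: cen b_def c_def)
    then have J4: "c * J (bas 4)$3 = - (b^2 + 1)" "J (bas 4)$4 = - b"
      using nz by (auto simp: power2_eq_square) (metis add_eq_0_iff mult.commute mult_minus_right mult_left_cancel)
    have "y$1 = 0" "y$2 = 0"
      by (simp_all add: y_def linear_add[OF lin] linear_scale[OF lin] cen)
    moreover have "y$3 = (- (c * J (bas 4)$3) / (b^2 + 1)) * e" "y$4 = 0"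
      by (simp_all add: y_def linear_add[OF lin] linear_scale[OF lin] cen J4(2))
    moreover have "y$3 = e"
      unfolding calculation(3) J4(1) minus_minus using q1[of b] by simp
    ultimately show ?thesis
      by (simp add: \<Phi>_def vec6_eq_iff)
  qed
  have "\<Phi> (J_G65 c r s *v x) = J (\<Phi> x)" for x
  proof (rule intertwining_G65_I[OF J complex_structure_J_G65 lin\<Phi>])
    show "c * s \<noteq> 0" using nz s by simp
    show "\<Phi> (J_G65 c r s *v bas 1) = J (\<Phi> (bas 1))"
      by (simp add: basJ linear_add[OF lin\<Phi>] linear_scale[OF lin\<Phi>] \<Phi>1 \<Phi>2)
    show "\<Phi> (J_G65 c r s *v bas 5) = J (\<Phi> (bas 5))"
      by (simp add: basJ linear_add[OF lin\<Phi>] linear_scale[OF lin\<Phi>] linear_scale[OF lin]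
          \<Phi>5 \<Phi>6 J5 algebra_simps power2_eq_square)
    define u where "u = \<Phi> (bas 4)"
    define K where "K = - c / (b^2 + 1)"
    have y: "y = K *\<^sub>R (J u + b *\<^sub>R u)"
      by (simp add: y_def u_def \<Phi>4 K_def)
    have Jy: "J y = K *\<^sub>R (- u + b *\<^sub>R J u)"
      unfolding y by (simp add: linear_neg[OF lin] linear_add[OF lin] linear_scale[OF lin] JJ)
    have "c = (- c / t) * (- t)" if "t \<noteq> 0" for t
      using that by simp
    from this[OF q1[of b]] have c: "c = K * (- (b^2 + 1))"
      unfolding K_def .
    have "J y = b *\<^sub>R y + c *\<^sub>R u"
      unfolding Jy unfolding y c by (simp add: vec_eq_iff algebra_simps power2_eq_square)
    then show "\<Phi> (J_G65 c r s *v bas 3) = J (\<Phi> (bas 3))"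
      by (simp add: basJ linear_add[OF lin\<Phi>] linear_scale[OF lin\<Phi>] \<Phi>3 flip: u_def)
  qed
  then have "equivalent_cs bracket_G65 J ((*v) (J_G65 c r s))"
    using J complex_structure_J_G65[of c s r] aut nz s
    by (intro lie_automorphism_equivalent_cs) auto
  then show ?thesis
    using nz s by (metis mult_eq_0_iff)
qed

section \<open>Equivalence of normal forms\<close>

text \<open>x4, x5 and x6 are iterated brackets of x1 and x2, so their images follow from those two;
  \<open>k\<close> is the determinant of the induced map modulo the span of x3, ..., x6.\<close>

lemma lie_automorphism_G65_images:
  fixes \<Phi> :: "real^6 \<Rightarrow> real^6"
  defines "k \<equiv> \<Phi> (bas 1) $ 1 * \<Phi> (bas 2) $ 2 - \<Phi> (bas 1) $ 2 * \<Phi> (bas 2) $ 1"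
  assumes "lie_automorphism bracket_G65 \<Phi>"
  shows "\<Phi> (bas 4) $ 1 = 0" "\<Phi> (bas 4) $ 2 = 0" "\<Phi> (bas 4) $ 3 = 0" "\<Phi> (bas 4) $ 4 = k"
    and "\<Phi> (bas 5) = (\<Phi> (bas 1) $ 1 * k) *\<^sub>R bas 5 + (\<Phi> (bas 1) $ 2 * k) *\<^sub>R bas 6"
    and "\<Phi> (bas 6) = (\<Phi> (bas 2) $ 1 * k) *\<^sub>R bas 5 + (\<Phi> (bas 2) $ 2 * k) *\<^sub>R bas 6"
proof -
  have br: "\<And>x y. \<Phi> (bracket_G65 x y) = bracket_G65 (\<Phi> x) (\<Phi> y)"
    using assms by (auto simp: lie_automorphism_def)
  have b: "bas 4 = bracket_G65 (bas 1) (bas 2)" "bas 5 = bracket_G65 (bas 1) (bas 4)"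
    "bas 6 = bracket_G65 (bas 2) (bas 4)"
    by (simp_all add: vec6_eq_iff)
  show p4: "\<Phi> (bas 4) $ 1 = 0" "\<Phi> (bas 4) $ 2 = 0" "\<Phi> (bas 4) $ 3 = 0" "\<Phi> (bas 4) $ 4 = k"
    by (simp_all add: b(1) br k_def)
  show "\<Phi> (bas 5) = (\<Phi> (bas 1) $ 1 * k) *\<^sub>R bas 5 + (\<Phi> (bas 1) $ 2 * k) *\<^sub>R bas 6"
    "\<Phi> (bas 6) = (\<Phi> (bas 2) $ 1 * k) *\<^sub>R bas 5 + (\<Phi> (bas 2) $ 2 * k) *\<^sub>R bas 6"
    unfolding b(2,3) br by (simp_all add: vec6_eq_iff p4)
qed

text \<open>The relations \<open>[x1, x3] = 0\<close> and \<open>[x2, x3] = x6\<close> give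
  equations for the first four coordinates of the image of x3. They force one off-diagonal or
  diagonal pair of the 2 x 2 block to vanish; in the antidiagonal case x3 goes to a multiple of x3 -
  x4 modulo the center.\<close>

lemma lie_automorphism_G65_cases:
  assumes "lie_automorphism bracket_G65 \<Phi>"
  obtains
    (diagonal) "\<Phi> (bas 1) $ 1 \<noteq> 0" "\<Phi> (bas 2) $ 2 \<noteq> 0" "\<Phi> (bas 1) $ 2 = 0" "\<Phi> (bas 2) $ 1 = 0"
      "\<Phi> (bas 3) $ 3 = \<Phi> (bas 1) $ 1 * \<Phi> (bas 2) $ 2" "\<Phi> (bas 3) $ 4 = 0"
  | (antidiagonal) "\<Phi> (bas 1) $ 2 \<noteq> 0" "\<Phi> (bas 2) $ 1 \<noteq> 0" "\<Phi> (bas 1) $ 1 = 0" "\<Phi> (bas 2) $ 2 = 0"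
      "\<Phi> (bas 3) $ 3 = \<Phi> (bas 1) $ 2 * \<Phi> (bas 2) $ 1"
      "\<Phi> (bas 3) $ 4 = - (\<Phi> (bas 1) $ 2 * \<Phi> (bas 2) $ 1)"
proof -
  have lin: "linear \<Phi>" and bij: "bij \<Phi>" and
    br: "\<And>x y. \<Phi> (bracket_G65 x y) = bracket_G65 (\<Phi> x) (\<Phi> y)"
    using assms by (auto simp: lie_automorphism_def)
  have ker: "\<Phi> x = 0 \<Longrightarrow> x = 0" for x
    using bij_is_inj[OF bij] linear_injective_0[OF lin] by blast
  have nz5: "\<Phi> (bas 5) \<noteq> 0"
    using ker[of "bas 5"] by auto
  have b6: "bas 6 = bracket_G65 (bas 2) (bas 3)" and b0: "bracket_G65 (bas 1) (bas 3) = 0"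
    by (simp_all add: vec6_eq_iff)
  define m11 m21 m12 m22 n1 n2 n3 n4 where
    m: "m11 = \<Phi> (bas 1) $ 1" "m21 = \<Phi> (bas 1) $ 2" "m12 = \<Phi> (bas 2) $ 1" "m22 = \<Phi> (bas 2) $ 2"
    and n: "n1 = \<Phi> (bas 3) $ 1" "n2 = \<Phi> (bas 3) $ 2" "n3 = \<Phi> (bas 3) $ 3" "n4 = \<Phi> (bas 3) $ 4"
  define k where "k = m11 * m22 - m21 * m12"
  note p5 = lie_automorphism_G65_images(5)[OF assms, folded m, folded k_def]
    and p6 = lie_automorphism_G65_images(6)[OF assms, folded m, folded k_def]
  have k: "k \<noteq> 0" using nz5 p5 by auto
  have "bracket_G65 (\<Phi> (bas 1)) (\<Phi> (bas 3)) = 0"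
    using br[of "bas 1" "bas 3"] by (simp add: b0 linear_0[OF lin])
  then have Z: "bracket_G65 (\<Phi> (bas 1)) (\<Phi> (bas 3)) $ i = 0" for i
    by simp
  have "bracket_G65 (\<Phi> (bas 2)) (\<Phi> (bas 3)) = (m12 * k) *\<^sub>R bas 5 + (m22 * k) *\<^sub>R bas 6"
    unfolding br[symmetric] b6[symmetric] p6 ..
  then have W: "bracket_G65 (\<Phi> (bas 2)) (\<Phi> (bas 3)) $ i = (m12 * k) * bas 5 $ i + (m22 * k) * bas 6 $ i" for i
    by simp
  have z: "m11 * n2 - m21 * n1 = 0" "m12 * n2 - m22 * n1 = 0"
    using Z[of 4] W[of 4] by (simp_all flip: m n)
  \<comment> \<open>Cramer's rule for the system \<open>z\<close>, whose determinant is
    \<open>k\<close> up to sign.\<close>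
  have n12: "n1 = 0" "n2 = 0"
  proof -
    have "k * n1 = m12 * (m11 * n2 - m21 * n1) - m11 * (m12 * n2 - m22 * n1)"
      "k * n2 = m22 * (m11 * n2 - m21 * n1) - m21 * (m12 * n2 - m22 * n1)"
      by (simp_all add: k_def algebra_simps)
    then show "n1 = 0" "n2 = 0"
      unfolding z using k by simp_all
  qed
  have "m11 * n4 = 0" "m21 * n3 + m21 * n4 = 0" "m12 * n4 = m12 * k" "m22 * n3 + m22 * n4 = m22 * k"
    using Z[of 5] Z[of 6] W[of 5] W[of 6] n12 by (simp_all flip: m n)
  note eqs = this(1) this(2)[folded distrib_left] this(3) this(4)[folded distrib_left]
  show thesis
  proof (cases "m11 = 0")
    case False
    then have "n4 = 0" using eqs by simp
    then have m12: "m12 = 0" using eqs k by simp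
    then have "m22 \<noteq> 0" using k by (auto simp: k_def)
    moreover from this have "n3 = k" using eqs \<open>n4 = 0\<close> by simp
    moreover from this have "m21 = 0" using eqs \<open>n4 = 0\<close> k by simp
    ultimately show thesis
      using False m12 \<open>n4 = 0\<close> by (intro diagonal) (simp_all add: k_def flip: m n)
  next
    case True
    then have mm: "m12 \<noteq> 0" "m21 \<noteq> 0" using k by (auto simp: k_def)
    then have "n4 = k" "n3 = - k" using eqs by auto
    moreover from this have "m22 = 0" using eqs k by auto
    ultimately show thesis
      using True mm by (intro antidiagonal) (simp_all add: k_def flip: m n)
  qed
qed

lemma J_G65_nth:
  "(J_G65 c r s *v x) $ 1 = (- ((r^2 + 1 - s*r*c) / (s*c))) * x$1 - ((- ((r^2 + 1 - s*r*c) / (s*c)))^2 + 1) * x$2"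
  "(J_G65 c r s *v x) $ 2 = x$1 - (- ((r^2 + 1 - s*r*c) / (s*c))) * x$2"
  "(J_G65 c r s *v x) $ 3 = (- (r + c - s*c)) * x$3 - (((- (r + c - s*c))^2 + 1) / c) * x$4"
  "(J_G65 c r s *v x) $ 4 = c * x$3 - (- (r + c - s*c)) * x$4"
  "(J_G65 c r s *v x) $ 5 = r * x$5 - ((r^2 + 1) / s) * x$6"
  "(J_G65 c r s *v x) $ 6 = s * x$5 - r * x$6"
  unfolding linear_vec6_expand[OF matrix_vector_mul_linear, of _ x] J_G65_basis
  by (simp_all add: algebra_simps)

text \<open>Comparing matrix entries yields \<open>s'\<close> in the left form, the classification
  states the right one. They agree because \<open>(r^2 + 1 - s*r*c)^2 + (s*c)^2\<close> is the
  squared modulus of a product of complex numbers with squared moduli \<open>r^2 + 1\<close> and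
  \<open>(s*c - r)^2 + 1\<close>.\<close>

lemma J_G65_param_identity:
  fixes c r s :: real
  assumes "c \<noteq> 0" "s \<noteq> 0"
  shows "(r^2 + 1) / (s * ((- ((r^2 + 1 - s*r*c) / (s*c)))^2 + 1)) = s * c^2 / ((s*c - r)^2 + 1)"
proof -
  define A where "A = (- ((r^2 + 1 - s*r*c) / (s*c)))^2 + 1"
  have "((- (u / v))^2 + 1) * v^2 = u^2 + v^2" if "v \<noteq> 0" for u v :: real
    using that by (simp add: power_divide distrib_right)
  then have "A * (s * c)^2 = (r^2 + 1 - s*r*c)^2 + (s * c)^2"
    using assms unfolding A_def by simp
  also have "\<dots> = (r^2 + 1) * ((s*c - r)^2 + 1)"
    by (simp add: power2_eq_square algebra_simps)
  also have "A * (s * c)^2 = s * c^2 * (s * A)"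
    by (simp add: power2_eq_square)
  finally have eq: "(r^2 + 1) * ((s*c - r)^2 + 1) = s * c^2 * (s * A)" ..
  have pos: "A > 0" "(s*c - r)^2 + 1 > 0"
    by (simp_all add: A_def add_nonneg_pos)
  then have nz: "s * A \<noteq> 0" "(s*c - r)^2 + 1 \<noteq> 0"
    using assms by (simp_all add: less_imp_neq[symmetric])
  show ?thesis
    unfolding A_def[symmetric] frac_eq_eq[OF nz] eq ..
qed

lemma equivalent_J_G65_imp:
  assumes nz: "c * s \<noteq> 0" "c' * s' \<noteq> 0"
    and "equivalent_cs bracket_G65 ((*v) (J_G65 c r s)) ((*v) (J_G65 c' r' s'))"
  shows "(c', r', s') = (c, r, s) \<or>
    (c' = - (((s*c - r)^2 + 1) / c) \<and> r' = - r \<and> s' = s * c^2 / ((s*c - r)^2 + 1))"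
proof -
  obtain \<Phi> where aut: "lie_automorphism bracket_G65 \<Phi>"
    and "(*v) (J_G65 c' r' s') = inv \<Phi> \<circ> (*v) (J_G65 c r s) \<circ> \<Phi>"
    using assms(3) by (auto simp: equivalent_cs_def)
  then have comm: "\<Phi> (J_G65 c' r' s' *v x) = J_G65 c r s *v \<Phi> x" for x
    by (simp add: fun_eq_iff lie_automorphism_def bij_inv_eq_iff surj_f_inv_f bij_is_surj)
  have lin: "linear \<Phi>"
    using aut by (simp add: lie_automorphism_def)
  have nz': "c \<noteq> 0" "s \<noteq> 0" "c' \<noteq> 0" "s' \<noteq> 0"
    using nz by auto
  define a b where "a = - ((r^2 + 1 - s*r*c) / (s*c))" and "b = - (r + c - s*c)"
  define a' b' where "a' = - ((r'^2 + 1 - s'*r'*c') / (s'*c'))" and "b' = - (r' + c' - s'*c')"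
  note nth = J_G65_nth[of c r s, folded a_def b_def]
  have eq: "a' *\<^sub>R \<Phi> (bas 1) + \<Phi> (bas 2) = J_G65 c r s *v \<Phi> (bas 1)"
    "b' *\<^sub>R \<Phi> (bas 3) + c' *\<^sub>R \<Phi> (bas 4) = J_G65 c r s *v \<Phi> (bas 3)"
    "r' *\<^sub>R \<Phi> (bas 5) + s' *\<^sub>R \<Phi> (bas 6) = J_G65 c r s *v \<Phi> (bas 5)"
    unfolding comm[symmetric] J_G65_basis[of c' r' s', folded a'_def b'_def]
    by (simp_all only: linear_add[OF lin] linear_scale[OF lin])
  have eqk: "a' * \<Phi> (bas 1) $ i + \<Phi> (bas 2) $ i = (J_G65 c r s *v \<Phi> (bas 1)) $ i"
    "b' * \<Phi> (bas 3) $ i + c' * \<Phi> (bas 4) $ i = (J_G65 c r s *v \<Phi> (bas 3)) $ i"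
    "r' * \<Phi> (bas 5) $ i + s' * \<Phi> (bas 6) $ i = (J_G65 c r s *v \<Phi> (bas 5)) $ i" for i
    unfolding eq[symmetric] by simp_all
  note im = lie_automorphism_G65_images[OF aut]
  show ?thesis
    using aut
  proof (cases rule: lie_automorphism_G65_cases)
    case diagonal
    have "\<Phi> (bas 2) $ 2 = \<Phi> (bas 1) $ 1"
      using eqk(1)[of 2] diagonal by (simp add: nth)
    moreover have "c' = c"
      using eqk(2)[of 4] diagonal by (simp add: nth im)
    moreover have "r' = r"
      using eqk(3)[of 5] diagonal by (simp add: nth im)
    moreover have "s' * \<Phi> (bas 2) $ 2 = s * \<Phi> (bas 1) $ 1"
      using eqk(3)[of 6] diagonal by (simp add: nth im)
    ultimately show ?thesis
      using diagonal by simp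
  next
    case antidiagonal
    define \<mu> \<nu> where \<mu>\<nu>: "\<mu> = \<Phi> (bas 1) $ 2" "\<nu> = \<Phi> (bas 2) $ 1"
    have \<nu>: "\<nu> = - ((a^2 + 1) * \<mu>)"
      using eqk(1)[of 1] antidiagonal by (simp add: nth \<mu>\<nu>)
    \<comment> \<open>Coordinate 4 of the equation for x3 determines \<open>b' + c'\<close> and
      coordinate 3 determines \<open>b'\<close>; subtracting gives \<open>c'\<close>.\<close>
    have "(b' + c') * (\<mu> * \<nu>) = - (b + c) * (\<mu> * \<nu>)"
      using eqk(2)[of 4] antidiagonal by (simp add: nth im algebra_simps flip: \<mu>\<nu>)
    then have bc: "b' + c' = - (b + c)"
      using antidiagonal by (simp add: \<mu>\<nu>)
    have "b' * (\<mu> * \<nu>) = (b + (b^2 + 1) / c) * (\<mu> * \<nu>)"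
      using eqk(2)[of 3] antidiagonal nz' by (simp add: nth im field_simps flip: \<mu>\<nu>)
    then have "b' = b + (b^2 + 1) / c"
      using antidiagonal by (simp add: \<mu>\<nu>)
    with bc have "c' = - (((b + c)^2 + 1) / c)"
      using nz' by (simp add: field_simps power2_eq_square)
    moreover have "b + c = s * c - r"
      by (simp add: b_def)
    moreover have "r' * (\<mu> * (\<mu> * \<nu>)) = - r * (\<mu> * (\<mu> * \<nu>))"
      using eqk(3)[of 6] antidiagonal by (simp add: nth im flip: \<mu>\<nu>)
    then have "r' = - r"
      using antidiagonal unfolding mult_cancel_right by (simp add: \<mu>\<nu>)
    moreover have "(- (s' * \<nu>)) * (\<mu> * \<nu>) = ((r^2 + 1) / s * \<mu>) * (\<mu> * \<nu>)"
      using eqk(3)[of 5] antidiagonal by (simp add: nth im flip: \<mu>\<nu>)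
    then have "- (s' * \<nu>) = (r^2 + 1) / s * \<mu>"
      using antidiagonal unfolding mult_cancel_right by (simp add: \<mu>\<nu>)
    then have "(s' * (a^2 + 1)) * \<mu> = ((r^2 + 1) / s) * \<mu>"
      by (simp add: \<nu> algebra_simps)
    then have "s' * (a^2 + 1) = (r^2 + 1) / s"
      using antidiagonal unfolding mult_cancel_right by (simp add: \<mu>\<nu>)
    moreover have "a^2 + 1 > 0"
      by (simp add: add_nonneg_pos)
    ultimately have "c' = - (((s * c - r)^2 + 1) / c)" "r' = - r"
      and s': "s' * (a^2 + 1) = (r^2 + 1) / s" and "a^2 + 1 > 0"
      by simp_all
    moreover have "s' * (s * (a^2 + 1)) = r^2 + 1"
      using nz' by (simp add: mult.left_commute[of s'] s')
    then have "s' = (r^2 + 1) / (s * (a^2 + 1))"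
      using nz' \<open>a^2 + 1 > 0\<close> by (intro eq_divide_imp) simp_all
    then have "s' = s * c^2 / ((s*c - r)^2 + 1)"
      using J_G65_param_identity[OF nz'(1,2), of r] by (simp add: a_def)
    ultimately show ?thesis by simp
  qed
qed

lemma equivalent_J_G65_swap:
  assumes nz: "c * s \<noteq> 0" "c' * s' \<noteq> 0"
    and c': "c' = - (((s*c - r)^2 + 1) / c)" and r': "r' = - r"
    and s': "s' = s * c^2 / ((s*c - r)^2 + 1)"
  shows "equivalent_cs bracket_G65 ((*v) (J_G65 c r s)) ((*v) (J_G65 c' r' s'))"
proof -
  have nz': "c \<noteq> 0" "s \<noteq> 0" "c' \<noteq> 0" "s' \<noteq> 0"
    using nz by auto
  define a b where "a = - ((r^2 + 1 - s*r*c) / (s*c))" and "b = - (r + c - s*c)"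
  define A t where "A = a^2 + 1" and "t = (b^2 + 1) / c"
  have A: "A > 0"
    by (simp add: A_def add_nonneg_pos)
  \<comment> \<open>The antidiagonal automorphism with \<open>\<mu> = 1\<close>, hence
    \<open>\<nu> = - A\<close> by the relation found in \<open>equivalent_J_G65_imp\<close>. The
    remaining columns are then dictated by brackets, up to central terms in the image of x3, set to
    0, and x5- and x6-terms in the image of x4, which vanish for this choice on x1 and x2.\<close>
  define \<Phi> :: "real^6 \<Rightarrow> real^6" where
    "\<Phi> x = vector [- A * x$2, x$1, - A * x$3, A * x$3 + A * x$4, - (A^2) * x$6, A * x$5]" for x
  have lin\<Phi>: "linear \<Phi>"
    by (simp add: linear_iff \<Phi>_def vec6_eq_iff algebra_simps)
  have "x = 0" if "\<Phi> x = 0" for x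
    using that A by (auto simp: \<Phi>_def vec6_eq_iff)
  then have "inj \<Phi>"
    by (simp add: linear_injective_0[OF lin\<Phi>])
  then have "bij \<Phi>"
    using linear_injective_imp_surjective[OF lin\<Phi>] by (simp add: bij_def)
  moreover have "\<Phi> (bracket_G65 x z) = bracket_G65 (\<Phi> x) (\<Phi> z)" for x z
    by (simp add: \<Phi>_def vec6_eq_iff algebra_simps power2_eq_square)
  ultimately have aut: "lie_automorphism bracket_G65 \<Phi>"
    using lin\<Phi> by (simp add: lie_automorphism_def)
  have q: "(s*c - r)^2 + 1 > 0"
    by (simp add: add_nonneg_pos)
  \<comment> \<open>The product of the two parameters changes sign under the swap; the entries
    \<open>- a\<close> and \<open>b + t\<close> of the second structure follow from this.\<close>
  have sc': "s' * c' = - (s * c)"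
  proof -
    have "s * c^2 / Q * - (Q / c) = - (s * c)" if "Q \<noteq> 0" for Q
      using that nz' by (simp add: power2_eq_square)
    from this[OF less_imp_neq[OF q, symmetric]] show ?thesis
      unfolding c' s' .
  qed
  have a': "- ((r'^2 + 1 - s'*r'*c') / (s'*c')) = - a"
    using sc' by (simp add: r' a_def mult.assoc mult.left_commute[of s'] mult.left_commute[of s])
  have b': "- (r' + c' - s'*c') = b + t"
    unfolding sc' using nz' by (simp add: r' c' t_def b_def field_simps power2_eq_square)
  have bc': "b + t + c' = - (b + c)"
    using b' sc' by (simp add: b_def r')
  have s'A: "s' * A = (r^2 + 1) / s"
    using J_G65_param_identity[OF nz'(1,2), of r] A nz'
    unfolding s'[symmetric] a_def[symmetric] A_def[symmetric] by (simp add: field_simps)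
  note nth = J_G65_nth[of c r s, folded a_def b_def, folded t_def]
  note bas' = J_G65_basis[of c' r' s', unfolded a' b']
  have "\<Phi> (J_G65 c' r' s' *v x) = J_G65 c r s *v \<Phi> x" for x
  proof (rule intertwining_G65_I[OF complex_structure_J_G65[OF nz(1)] complex_structure_J_G65[OF nz(2)] lin\<Phi>])
    show "\<Phi> (J_G65 c' r' s' *v bas 1) = J_G65 c r s *v \<Phi> (bas 1)"
      unfolding bas' by (simp add: vec6_eq_iff nth \<Phi>_def A_def)
    show "\<Phi> (J_G65 c' r' s' *v bas 3) = J_G65 c r s *v \<Phi> (bas 3)"
    proof -
      have "A * (b + t) + A * c' = A * (- (b + c))"
        by (simp only: bc' flip: distrib_left)
      then show ?thesis
        unfolding bas' by (simp add: vec6_eq_iff nth \<Phi>_def algebra_simps)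
    qed
    have "A^2 * s' = A * ((r^2 + 1) / s)"
      unfolding s'A[symmetric] by (simp add: power2_eq_square)
    then show "\<Phi> (J_G65 c' r' s' *v bas 5) = J_G65 c r s *v \<Phi> (bas 5)"
      unfolding bas' by (simp add: vec6_eq_iff nth \<Phi>_def r')
  qed
  then show ?thesis
    using complex_structure_J_G65[OF nz(1)] complex_structure_J_G65[OF nz(2)] aut
    by (intro lie_automorphism_equivalent_cs) auto
qed

lemma equivalent_J_G65_refl:
  assumes "c * s \<noteq> 0"
  shows "equivalent_cs bracket_G65 ((*v) (J_G65 c r s)) ((*v) (J_G65 c r s))"
proof (rule lie_automorphism_equivalent_cs)
  show "lie_automorphism bracket_G65 (\<lambda>x. x)"
    by (simp add: lie_automorphism_def linear_ident bij_id[unfolded id_def])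
qed (use complex_structure_J_G65[OF assms] in auto)

section \<open>The submanifold of complex structures\<close>

lemma matrix_mult_bas_nth: "((A :: real^6^6) *v bas j) $ k = A $ k $ j"
  by (simp add: matrix_vector_mult_basis column_def)

lemma matrix_eq_iff_bas: "(A :: real^6^6) = B \<longleftrightarrow> (\<forall>j. A *v bas j = B *v bas j)"
  by (auto simp: vec_eq_iff matrix_mult_bas_nth)

definition col_matrix :: "6 \<Rightarrow> real^6 \<Rightarrow> real^6^6" where
  "col_matrix j v = (\<chi> k i. if i = j then v $ k else 0)"

lemma linear_col_matrix: "linear (col_matrix j)"
  by (auto simp: linear_iff col_matrix_def vec_eq_iff)

lemma col_matrix_mult_bas: "col_matrix j v *v bas i = (if i = j then v else 0)"
  by (simp add: vec_eq_iff matrix_mult_bas_nth col_matrix_def)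

definition free_entries :: "(6 \<times> 6) set" where
  "free_entries = {(1,1), (2,1), (3,1), (4,1), (5,1), (6,1), (3,3), (4,3), (5,3), (6,3)}"

definition free_part :: "real^6^6 \<Rightarrow> real^6^6" where
  "free_part A = (\<chi> k j. if (k, j) \<in> free_entries then A $ k $ j else 0)"

text \<open>\<open>E\<close> lists the matrix units, which are the standard basis. The range of the
  coordinate projection is its fixed space, spanned by the units at the ten free positions.\<close>

lemma dim_range_free_part: "dim (range free_part) = 10"
proof -
  define E :: "6 \<times> 6 \<Rightarrow> real^6^6" where "E p = axis (fst p) (axis (snd p) 1)" for p
  have inj: "inj E"
    by (auto simp: inj_def E_def axis_eq_axis axis_eq_0_iff)
  have "axis i (bas j) \<in> range E" for i j
    using rangeI[of E "(i, j)"] by (simp add: E_def)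
  then have basis: "Basis = range E"
    by (auto simp: Basis_vec_def E_def)
  have inner: "x \<bullet> E p = x $ fst p $ snd p" for x p
    by (simp add: E_def inner_axis)
  have "free_part x = x \<longleftrightarrow> (\<forall>p. p \<notin> free_entries \<longrightarrow> x $ fst p $ snd p = 0)" for x
    unfolding vec_eq_iff free_part_def by (auto simp: eq_commute[of 0])
  moreover have "free_part (free_part x) = free_part x" for x
    by (simp add: free_part_def vec_eq_iff)
  then have "range free_part = {x. free_part x = x}"
    by (metis (mono_tags, lifting) image_iff mem_Collect_eq set_eqI rangeI)
  ultimately have eq: "range free_part = {x. \<forall>i\<in>Basis. i \<notin> E ` free_entries \<longrightarrow> x \<bullet> i = 0}"
    by (simp add: basis inner inj_image_mem_iff[OF inj])
  have "E ` free_entries \<subseteq> Basis"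
    unfolding basis by blast
  then have "dim (range free_part) = card (E ` free_entries)"
    unfolding eq by (rule dim_substandard)
  also have "\<dots> = card free_entries"
    by (rule card_image[OF inj_on_subset[OF inj subset_UNIV]])
  also have "\<dots> = 10"
    by (simp add: free_entries_def)
  finally show ?thesis .
qed

text \<open>For \<open>A\<close> with the given free entries, \<open>cs_r A\<close> and \<open>cs_s A\<close> are the entries of column 5
  forced by the torsion equation, and \<open>cs_col4\<close>, \<open>cs_col6\<close>, \<open>cs_col2\<close> solve
  \<open>J (J x\<^sub>3) = - x\<^sub>3\<close>, \<open>J (J x\<^sub>5) = - x\<^sub>5\<close>, \<open>J (J x\<^sub>1) = - x\<^sub>1\<close>.\<close>

definition cs_r :: "real^6^6 \<Rightarrow> real" where
  "cs_r A = (A$1$1 * (A$3$3 + A$4$3) + 1) / (A$3$3 + A$4$3 - A$1$1)"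

definition cs_s :: "real^6^6 \<Rightarrow> real" where
  "cs_s A = A$2$1 * ((A$3$3 + A$4$3) * (A$3$3 + A$4$3) + 1) / (A$4$3 * (A$3$3 + A$4$3 - A$1$1))"

text \<open>The conditions \<open>e \<noteq> 0\<close>, \<open>c \<noteq> 0\<close>,
  \<open>q \<noteq> a\<close> of \<open>complex_structure_G65_iff\<close>. They keep all
  denominators of the graph nonzero, including \<open>cs_s\<close>.\<close>

definition cs_domain :: "(real^6^6) set" where
  "cs_domain = {A. A$2$1 \<noteq> 0 \<and> A$4$3 \<noteq> 0 \<and> A$3$3 + A$4$3 - A$1$1 \<noteq> 0}"

definition cs_col3 :: "real^6^6 \<Rightarrow> real^6" where
  "cs_col3 A = A$3$3 *\<^sub>R bas 3 + A$4$3 *\<^sub>R bas 4 + A$5$3 *\<^sub>R bas 5 + A$6$3 *\<^sub>R bas 6"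

definition cs_col5 :: "real^6^6 \<Rightarrow> real^6" where
  "cs_col5 A = cs_r A *\<^sub>R bas 5 + cs_s A *\<^sub>R bas 6"

definition cs_col6 :: "real^6^6 \<Rightarrow> real^6" where
  "cs_col6 A = (- 1 / cs_s A) *\<^sub>R (bas 5 + cs_r A *\<^sub>R cs_col5 A)"

definition cs_col4 :: "real^6^6 \<Rightarrow> real^6" where
  "cs_col4 A = (- 1 / A$4$3) *\<^sub>R (bas 3 + A$3$3 *\<^sub>R cs_col3 A + A$5$3 *\<^sub>R cs_col5 A + A$6$3 *\<^sub>R cs_col6 A)"

definition cs_col2 :: "real^6^6 \<Rightarrow> real^6" where
  "cs_col2 A = (- 1 / A$2$1) *\<^sub>R (bas 1 + A$1$1 *\<^sub>R (A *v bas 1) + A$3$1 *\<^sub>R cs_col3 A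
    + A$4$1 *\<^sub>R cs_col4 A + A$5$1 *\<^sub>R cs_col5 A + A$6$1 *\<^sub>R cs_col6 A)"

text \<open>Column 3 has no summand: outside the free positions its entries are zero for a complex
  structure.\<close>

definition cs_graph :: "real^6^6 \<Rightarrow> real^6^6" where
  "cs_graph A = col_matrix 2 (cs_col2 A) + col_matrix 4 (cs_col4 A)
    + col_matrix 5 (cs_col5 A) + col_matrix 6 (cs_col6 A)"

lemma cs_s_nonzero: "A \<in> cs_domain \<Longrightarrow> cs_s A \<noteq> 0"
proof -
  assume "A \<in> cs_domain"
  moreover have "x * x + 1 \<noteq> 0" for x :: real
    by (metis add_nonneg_pos less_irrefl zero_le_square zero_less_one)
  ultimately show ?thesis
    by (simp add: cs_s_def cs_domain_def)
qed

lemma open_cs_domain: "open cs_domain"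
proof -
  have eq: "cs_domain = {A. A$2$1 \<noteq> 0} \<inter> {A. A$4$3 \<noteq> 0} \<inter> {A. A$3$3 + A$4$3 - A$1$1 \<noteq> 0}"
    by (auto simp: cs_domain_def)
  show ?thesis
    unfolding eq by (intro open_Int open_Collect_neq continuous_intros)
qed

lemma smooth_on_cs_graph: "smooth_on cs_graph cs_domain"
proof -
  note op = open_cs_domain
  have dom: "A$2$1 \<noteq> 0" "A$4$3 \<noteq> 0" "A$3$3 + A$4$3 - A$1$1 \<noteq> 0"
    "A$4$3 * (A$3$3 + A$4$3 - A$1$1) \<noteq> 0" if "A \<in> cs_domain" for A
    using that unfolding cs_domain_def by simp_all
  have entry: "smooth_on (\<lambda>A :: real^6^6. A$k$j) cs_domain" for k j
    by (intro smooth_on_linear op) (simp add: linear_iff)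
  have col1: "smooth_on (\<lambda>A :: real^6^6. A *v bas 1) cs_domain"
    by (intro smooth_on_linear op)
      (simp add: linear_iff vec_eq_iff matrix_mult_bas_nth)
  note intros = op smooth_on_const smooth_on_add smooth_on_diff smooth_on_scaleR smooth_on_mult
    smooth_on_divide entry col1 dom cs_s_nonzero
  have r: "smooth_on cs_r cs_domain"
    unfolding cs_r_def[abs_def] by (intro intros)
  have s: "smooth_on cs_s cs_domain"
    unfolding cs_s_def[abs_def] by (intro intros)
  have col3: "smooth_on cs_col3 cs_domain"
    unfolding cs_col3_def[abs_def] by (intro intros)
  have col5: "smooth_on cs_col5 cs_domain"
    unfolding cs_col5_def[abs_def] by (intro intros r s)
  have col6: "smooth_on cs_col6 cs_domain"
    unfolding cs_col6_def[abs_def] by (intro intros r s col5)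
  have col4: "smooth_on cs_col4 cs_domain"
    unfolding cs_col4_def[abs_def] by (intro intros col3 col5 col6)
  have col2: "smooth_on cs_col2 cs_domain"
    unfolding cs_col2_def[abs_def] by (intro intros col3 col4 col5 col6)
  have col_matrix: "smooth_on (\<lambda>A. col_matrix j (f A)) cs_domain" if "smooth_on f cs_domain" for j f
    using op linear_col_matrix that by (rule smooth_on_linear_image)
  show ?thesis
    unfolding cs_graph_def[abs_def] by (intro smooth_on_add op col_matrix col2 col4 col5 col6)
qed

text \<open>Outside \<open>cs_domain\<close> both sides fail. Inside, the columns are compared in
  the order 3, 5, 6, 4, 2, in which each column formula uses only earlier columns and column 1, and
  amounts to one condition of \<open>complex_structure_G65_iff\<close>.\<close>

lemma complex_structure_matrices_G65_graph:
  "A \<in> complex_structure_matrices bracket_G65 \<longleftrightarrow> A \<in> cs_domain \<and> A = free_part A + cs_graph A"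
proof (cases "A \<in> cs_domain")
  case False
  then show ?thesis
    unfolding complex_structure_matrices_def mem_Collect_eq complex_structure_G65_iff
    by (auto simp: cs_domain_def matrix_mult_bas_nth)
next
  case True
  then have nz: "A$2$1 \<noteq> 0" "A$4$3 \<noteq> 0" "A$3$3 + A$4$3 \<noteq> A$1$1"
    by (auto simp: cs_domain_def)
  let ?c = "\<lambda>j. A *v bas j"
  have lin: "linear ((*v) A)" by (rule matrix_vector_mul_linear)
  have col: "x = (- 1 / t) *\<^sub>R w \<longleftrightarrow> t *\<^sub>R x + w = 0" if "t \<noteq> 0" for t and x w :: "real^6"
  proof
    assume "t *\<^sub>R x + w = 0"
    then have "w = - (t *\<^sub>R x)"
      by (simp add: eq_neg_iff_add_eq_0 add.commute)
    then show "x = (- 1 / t) *\<^sub>R w"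
      using that by simp
  qed (use that in simp)
  have free1: "free_part A *v bas 1 = ?c 1" and free3: "free_part A *v bas 3 = cs_col3 A"
    by (simp_all add: vec6_eq_iff matrix_mult_bas_nth free_part_def free_entries_def cs_col3_def)
  have free0: "free_part A *v bas j = 0" if "j \<notin> {1, 3}" for j
    using that by (simp add: vec_eq_iff matrix_mult_bas_nth free_part_def free_entries_def)
  have "A = free_part A + cs_graph A \<longleftrightarrow> ?c 3 = cs_col3 A \<and> ?c 5 = cs_col5 A \<and> ?c 6 = cs_col6 A
      \<and> ?c 4 = cs_col4 A \<and> ?c 2 = cs_col2 A" (is "_ \<longleftrightarrow> ?cols")
    unfolding matrix_eq_iff_bas forall_6
    by (auto simp: matrix_vector_mult_add_rdistrib cs_graph_def col_matrix_mult_bas free1 free3 free0)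
  also have "?cols \<longleftrightarrow> ?c 3 $ 1 = 0 \<and> ?c 3 $ 2 = 0 \<and> ?c 5 = cs_col5 A
      \<and> A *v ?c 5 = - bas 5 \<and> A *v ?c 3 = - bas 3 \<and> A *v ?c 1 = - bas 1"
  proof -
    have 3: "?c 3 = cs_col3 A \<longleftrightarrow> ?c 3 $ 1 = 0 \<and> ?c 3 $ 2 = 0"
      by (auto simp: vec6_eq_iff cs_col3_def matrix_mult_bas_nth)
    have 6: "?c 6 = cs_col6 A \<longleftrightarrow> A *v ?c 5 = - bas 5" if "?c 5 = cs_col5 A"
    proof -
      have "A *v ?c 5 = cs_r A *\<^sub>R ?c 5 + cs_s A *\<^sub>R ?c 6"
        unfolding that(1) unfolding cs_col5_def
        by (simp add: linear_add[OF lin] linear_scale[OF lin] that[unfolded cs_col5_def])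
      then show ?thesis
        unfolding cs_col6_def col[OF cs_s_nonzero[OF True]] eq_neg_iff_add_eq_0
        by (simp add: that algebra_simps)
    qed
    have 4: "?c 4 = cs_col4 A \<longleftrightarrow> A *v ?c 3 = - bas 3"
      if "?c 3 = cs_col3 A" "?c 5 = cs_col5 A" "?c 6 = cs_col6 A"
    proof -
      have "A *v ?c 3 = A$3$3 *\<^sub>R ?c 3 + A$4$3 *\<^sub>R ?c 4 + A$5$3 *\<^sub>R ?c 5 + A$6$3 *\<^sub>R ?c 6"
        using iffD1[OF 3 that(1), unfolded matrix_mult_bas_nth]
        by (subst linear_vec6_expand[OF lin, of "?c 3"]) (simp add: matrix_mult_bas_nth)
      then show ?thesis
        unfolding cs_col4_def col[OF nz(2)] eq_neg_iff_add_eq_0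
        by (simp add: that algebra_simps)
    qed
    have 2: "?c 2 = cs_col2 A \<longleftrightarrow> A *v ?c 1 = - bas 1"
      if "?c 3 = cs_col3 A" "?c 5 = cs_col5 A" "?c 6 = cs_col6 A" "?c 4 = cs_col4 A"
    proof -
      have "A *v ?c 1 = A$1$1 *\<^sub>R ?c 1 + A$2$1 *\<^sub>R ?c 2 + A$3$1 *\<^sub>R ?c 3 + A$4$1 *\<^sub>R ?c 4
          + A$5$1 *\<^sub>R ?c 5 + A$6$1 *\<^sub>R ?c 6"
        by (subst linear_vec6_expand[OF lin, of "?c 1"]) (simp add: matrix_mult_bas_nth)
      then show ?thesis
        unfolding cs_col2_def col[OF nz(1)] eq_neg_iff_add_eq_0
        by (simp add: that algebra_simps)
    qed
    \<comment> \<open>Each equivalence holds only under the preceding column equations; this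
      propositional pattern chains them into a single one.\<close>
    have "(P3 \<and> P5 \<and> P6 \<and> P4 \<and> P2) = (X \<and> Y \<and> P5 \<and> Q5 \<and> Q3 \<and> Q1)"
      if "P3 = (X \<and> Y)" "P5 \<Longrightarrow> P6 = Q5" "P3 \<Longrightarrow> P5 \<Longrightarrow> P6 \<Longrightarrow> P4 = Q3"
        "P3 \<Longrightarrow> P5 \<Longrightarrow> P6 \<Longrightarrow> P4 \<Longrightarrow> P2 = Q1"
      for P2 P3 P4 P5 P6 Q1 Q3 Q5 X Y
      using that by blast
    from this[OF 3 6 4 2] show ?thesis .
  qed
  also have "\<dots> \<longleftrightarrow> complex_structure bracket_G65 ((*v) A)"
    unfolding complex_structure_G65_iff
    using nz lin by (auto simp: cs_col5_def cs_r_def cs_s_def matrix_mult_bas_nth power2_eq_square)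
  finally show ?thesis
    using True by (simp add: complex_structure_matrices_def)
qed

lemma smooth_submanifold_complex_structure_matrices_G65:
  "smooth_submanifold 10 (complex_structure_matrices bracket_G65)"
proof -
  have entry: "free_part A$1$1 = A$1$1" "free_part A$2$1 = A$2$1" "free_part A$3$1 = A$3$1"
    "free_part A$4$1 = A$4$1" "free_part A$5$1 = A$5$1" "free_part A$6$1 = A$6$1"
    "free_part A$3$3 = A$3$3" "free_part A$4$3 = A$4$3" "free_part A$5$3 = A$5$3"
    "free_part A$6$3 = A$6$3" for A
    by (simp_all add: free_part_def free_entries_def)
  have col1: "free_part A *v bas 1 = A *v bas 1" for A
    by (simp add: vec6_eq_iff matrix_mult_bas_nth entry)
  have "smooth_submanifold (dim (range free_part)) (complex_structure_matrices bracket_G65)"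
  proof (rule smooth_submanifold_graph)
    show "linear free_part"
      by (auto simp: linear_iff free_part_def vec_eq_iff)
    show "free_part (free_part A) = free_part A" for A
      by (simp add: free_part_def vec_eq_iff)
    show "open cs_domain" by (rule open_cs_domain)
    show "free_part A \<in> cs_domain \<longleftrightarrow> A \<in> cs_domain" for A
      by (simp add: cs_domain_def entry)
    show "smooth_on cs_graph cs_domain" by (rule smooth_on_cs_graph)
    show "cs_graph (free_part A) = cs_graph A" for A
      by (simp add: cs_graph_def cs_col2_def cs_col3_def cs_col4_def cs_col5_def cs_col6_def
          cs_r_def cs_s_def entry col1)
    show "free_part (cs_graph A) = 0" for A
    proof -
      have "cs_graph A $ k $ j = 0" if "(k, j) \<in> free_entries" for k j
        using that by (auto simp: free_entries_def cs_graph_def col_matrix_def cs_col5_def cs_col6_def)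
      then show ?thesis
        by (simp add: free_part_def vec_eq_iff)
    qed
  qed (rule complex_structure_matrices_G65_graph)
  then show ?thesis
    by (simp only: dim_range_free_part)
qed

theorem mainTheorem6:
  shows "smooth_submanifold 10 (complex_structure_matrices bracket_G65) \<and>
    (\<forall>J. complex_structure bracket_G65 J \<longrightarrow>
       (\<exists>c r s. c * s \<noteq> 0 \<and> equivalent_cs bracket_G65 J ((*v) (J_G65 c r s)))) \<and>
    (\<forall>c r s c' r' s'. c * s \<noteq> 0 \<longrightarrow> c' * s' \<noteq> 0 \<longrightarrow>
       (equivalent_cs bracket_G65 ((*v) (J_G65 c r s)) ((*v) (J_G65 c' r' s')) \<longleftrightarrow>
          (c', r', s') = (c, r, s) \<or>
          (c' = - (((s*c - r)^2 + 1) / c) \<and> r' = - r \<and>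
           s' = s * c^2 / ((s*c - r)^2 + 1))))"
  using smooth_submanifold_complex_structure_matrices_G65 complex_structure_G65_normal_form
    equivalent_J_G65_imp equivalent_J_G65_swap equivalent_J_G65_refl
  by (intro conjI allI impI iffI; blast)

end
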